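(* A partition $\mu$ is a flagpole partition if and only if there exist a partition $\lambda$ and an integer $a\ge a_0(\lambda)$ such that $\mathrm{TI}_2(\mu)=[v(\lambda,a,0)]$ or $\mathrm{TI}_2(\mu)=[v(\lambda,a,1)]$.
   Context: A quasi-Dyck vector (QDV) is an integer sequence $v=v_1v_2\cdots v_n$ with $v_1=0$ and $v_{i+1}\le v_i+1$ for all $i<n$. We use word notation; $i^c$ means $c$ copies of the symbol $i$; $W^{+}$ adds $1$ to each entry of $W$. Dyck classes $[v]$ are the equivalence classes of the equivalence relation on QDVs generated by $v\sim 0v^+$. An integer partition $\lambda$ (with $\ell(\lambda)$ positive parts and $\lambda_i=0$ for $i>\ell(\lambda)$; the zero partition $\langle 0\rangle=[0]$ is allowed) is identified with the Dyck class consisting of all QDVs $\mathrm{QDV}_n(\lambda)=(0-\lambda_n,1-\lambda_{n-1},\ldots,n-1-\lambda_1)$, $n>\ell(\lambda)$; this is a bijection between partitions and Dyck classes. $\mathrm{min}_{\Delta}(\lambda)$ is the least $n>\ell(\lambda)$ such that $\mathrm{QDV}_n(\lambda)$ has all entries nonnegative. The maps. $\mathrm{NU}_1$ is defined on $D_1=\{\gamma:\gamma_1\le\ell(\gamma)+2\}$ by $\mathrm{NU}_1(\gamma)=\langle\ell+1,\gamma_1-1,\ldots,\gamma_\ell-1\rangle$, $\ell=\ell(\gamma)$ (zero parts dropped); it is a bijection from $D_1$ onto $C_1=\{\gamma\ne\langle 0\rangle:\gamma_1\ge\ell(\gamma)\}$. $\mathrm{NU}_2$ is defined by two rules. Rule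 (a): $\mathrm{NU}_2([012^hA(-1)^{h-1}])=[00^{h-1}1A1^h]$ for $h\ge 2$ and $A=A_1\cdots A_s$ a list of integers that is empty or satisfies all $A_i\le 2$, $A_s\ge 0$, $A_{i+1}\le A_i+1$ for $i<s$. Rule (b): $\mathrm{NU}_2([012^kB(-1)^k])=[00^kB01^k]$ for $k\ge 1$ and $B=B_1\cdots B_s$ a list of integers that is empty or satisfies all $B_i\le 2$, $B_1\le 1$, $B_s\ge -1$, $B_{i+1}\le B_i+1$ for $i<s$. $\mathrm{NU}_2$ is a bijection from its domain $D_2$ onto its image $C_2$, with $D_1\cap D_2=\emptyset=C_1\cap C_2$; $\mathrm{NU}$ is the combined bijection $D_1\cup D_2\to C_1\cup C_2$ and $\mathrm{ND}$ is its inverse. For nonzero $\mu=\langle r^{n_r}\cdots 2^{n_2}1^{n_1}\rangle$ with $n_r>0$ ($n_i$ parts equal to $i$), $B_\mu=01^{n_1}01^{n_2}\cdots 01^{n_r}$; $B_{\langle 0\rangle}$ is empty; $\mathrm{TI}(\mu)=[0B_\mu]$. $\mathrm{TI}_2(\mu)$ is the Dyck class obtained by starting at $\mathrm{TI}(\mu)$ and iterating $\mathrm{ND}$ as many times as possible (this always terminates). A flagpole partition is an integer partition $\mu$ with $|\mu|+8\le 2\,\mathrm{min}_{\Delta}(\mathrm{TI}_2(\mu))$. For a partition $\lambda$, $a_0(\lambda)=|\lambda|-\lambda_1-\ell(\lambda)+3$ (always $\ge 2$). For $a\ge 2$, $v(\lambda,a,0)=0012^aB_\lambda^+$ and $v(\lambda,a,1)=0012^{a-1}B_\lambda^+1$.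 *)

theory Defs
  imports Main
begin

section \<open>Integer partitions\<close>

text \<open>Partitions are weakly decreasing lists of positive integers; the zero partition is \<open>[]\<close>.\<close>

definition is_partition :: "nat list \<Rightarrow> bool" where
  "is_partition \<nu> \<longleftrightarrow> sorted_wrt (\<ge>) \<nu> \<and> (\<forall>p\<in>set \<nu>. 0 < p)"

text \<open>The parts are indexed from \<open>1\<close>, and \<open>part \<nu> i = 0\<close> for \<open>i > length \<nu>\<close>.\<close>

definition part :: "nat list \<Rightarrow> nat \<Rightarrow> nat" where
  "part \<nu> i = (if 1 \<le> i \<and> i \<le> length \<nu> then \<nu> ! (i - 1) else 0)"

section \<open>Quasi-Dyck vectors and Dyck classes\<close>

definition rise_le1 :: "int list \<Rightarrow> bool" where
  "rise_le1 v \<longleftrightarrow> (\<forall>i. Suc i < length v \<longrightarrow> v ! Suc i \<le> v ! i + 1)"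

definition qdv :: "int list \<Rightarrow> bool" where
  "qdv v \<longleftrightarrow> v \<noteq> [] \<and> hd v = 0 \<and> rise_le1 v"

definition shift_up :: "int list \<Rightarrow> int list" where
  "shift_up v = map (\<lambda>x. x + 1) v"

definition dyck_step :: "int list \<Rightarrow> int list \<Rightarrow> bool" where
  "dyck_step v w \<longleftrightarrow> qdv v \<and> w = 0 # shift_up v"

text \<open>The class \<open>[v]\<close>; it is only meaningful for a QDV \<open>v\<close>, and then all its elements are QDVs.\<close>

definition dyck_class :: "int list \<Rightarrow> int list set" where
  "dyck_class v = {w. equivclp dyck_step v w}"

text \<open>\<open>QDV n \<nu> = (0 - \<nu>\<^sub>n, 1 - \<nu>\<^sub>n\<^sub>-\<^sub>1, \<dots>, n - 1 - \<nu>\<^sub>1)\<close>; the list index \<open>j\<close> runs from \<open>0\<close>.\<close>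

definition QDV :: "nat \<Rightarrow> nat list \<Rightarrow> int list" where
  "QDV n \<nu> = map (\<lambda>j. int j - int (part \<nu> (n - j))) [0..<n]"

definition class_of :: "nat list \<Rightarrow> int list set" where
  "class_of \<nu> = {QDV n \<nu> | n. n > length \<nu>}"

lemma QDV_Suc:
  assumes "length \<nu> \<le> n"
  shows "QDV (Suc n) \<nu> = 0 # shift_up (QDV n \<nu>)"
  using assms
  by (auto simp: QDV_def shift_up_def part_def upt_conv_Cons map_Suc_upt[symmetric]
      simp del: upt_Suc)

lemma qdv_QDV:
  assumes "is_partition \<nu>" and "length \<nu> < n"
  shows "qdv (QDV n \<nu>)"
proof -
  have mono: "part \<nu> (Suc i) \<le> part \<nu> i" if "1 \<le> i" for i
    using assms(1) that by (auto simp: is_partition_def part_def sorted_wrt_iff_nth_less)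
  have "QDV n \<nu> ! Suc i \<le> QDV n \<nu> ! i + 1" if "Suc i < n" for i
    using mono[of "n - Suc i"] that by (auto simp: QDV_def Suc_diff_Suc)
  moreover have "hd (QDV n \<nu>) = 0" "length (QDV n \<nu>) = n"
    using assms(2) by (auto simp: QDV_def hd_map part_def)
  ultimately show ?thesis
    using assms(2) by (auto simp: qdv_def rise_le1_def)
qed

lemma class_of_eq_dyck_class:
  assumes "is_partition \<nu>" and "length \<nu> < n"
  shows "class_of \<nu> = dyck_class (QDV n \<nu>)"
proof -
  have step: "dyck_step (QDV m \<nu>) (QDV (Suc m) \<nu>)" if "length \<nu> < m" for m
    using that assms(1) by (simp add: dyck_step_def qdv_QDV QDV_Suc)
  have base: "equivclp dyck_step (QDV (Suc (length \<nu>)) \<nu>) (QDV (Suc (length \<nu>) + k) \<nu>)" for k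
  proof (induction k)
    case (Suc k)
    from step[of "Suc (length \<nu>) + k"] Suc show ?case
      by (auto intro: equivclp_into_equivclp)
  qed simp
  have "equivclp dyck_step (QDV n \<nu>) (QDV m \<nu>)" if "length \<nu> < m" for m
    using base[of "n - Suc (length \<nu>)"] base[of "m - Suc (length \<nu>)"] that assms(2)
    by (simp, meson equivclp_sym equivclp_trans)
  moreover have "\<exists>m > length \<nu>. w = QDV m \<nu>" if "equivclp dyck_step (QDV n \<nu>) w" for w
    using that
  proof (induction rule: equivclp_induct)
    case base
    then show ?case using assms(2) by blast
  next
    case (step y z)
    then obtain m where m: "length \<nu> < m" "y = QDV m \<nu>" by blast
    from step(2) show ?case
    proof
      assume "dyck_step y z"
      then have "z = QDV (Suc m) \<nu>" using m by (simp add: dyck_step_def QDV_Suc)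
      then show ?thesis using m by (intro exI[of _ "Suc m"]) simp
    next
      assume zy: "dyck_step z y"
      obtain k where k: "m = Suc k" "length \<nu> \<le> k" using m(1) by (cases m) auto
      have "inj (\<lambda>x::int. x + 1)" by (simp add: inj_def)
      then have z: "z = QDV k \<nu>"
        using zy m k by (auto simp: dyck_step_def QDV_Suc shift_up_def inj_map_eq_map)
      have "k \<noteq> length \<nu>"
      proof
        assume eq: "k = length \<nu>"
        with zy z have "QDV k \<nu> \<noteq> []" "hd (QDV k \<nu>) = 0" by (auto simp: dyck_step_def qdv_def)
        then have "0 < k" "part \<nu> k = 0" by (auto simp: QDV_def hd_map)
        moreover have "\<nu> ! (k - 1) \<in> set \<nu>" using \<open>0 < k\<close> eq by simp
        moreover have "part \<nu> k = \<nu> ! (k - 1)" using \<open>0 < k\<close> eq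
          by (simp add: part_def Suc_le_eq)
        ultimately show False using assms(1) by (metis is_partition_def less_irrefl)
      qed
      then show ?thesis using z k by (intro exI[of _ k]) auto
    qed
  qed
  ultimately show ?thesis by (auto simp: class_of_def dyck_class_def)
qed

lemma class_of_inj:
  assumes "is_partition \<mu>" "is_partition \<nu>" "class_of \<mu> = class_of \<nu>"
  shows "\<mu> = \<nu>"
proof -
  define n where "n = Suc (length \<mu> + length \<nu>)"
  have "QDV n \<mu> \<in> class_of \<mu>"
    unfolding class_of_def n_def by force
  then have "QDV n \<mu> \<in> class_of \<nu>"
    using assms(3) by simp
  then obtain m where "QDV n \<mu> = QDV m \<nu>" by (auto simp: class_of_def)
  moreover have "length (QDV k \<kappa>) = k" for k \<kappa> by (simp add: QDV_def)
  ultimately have "QDV n \<mu> = QDV n \<nu>" by metis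
  then have eq: "part \<mu> (n - j) = part \<nu> (n - j)" if "j < n" for j
    using that by (auto simp: QDV_def)
  have parts: "part \<mu> i = part \<nu> i" for i
  proof (cases "1 \<le> i \<and> i \<le> n")
    case True
    then show ?thesis using eq[of "n - i"] by simp
  qed (auto simp: part_def n_def)
  have pos: "i \<le> length \<kappa> \<longleftrightarrow> part \<kappa> i \<noteq> 0" if "is_partition \<kappa>" "1 \<le> i" for \<kappa> i
    using that by (auto simp: part_def is_partition_def)
  have le: "i \<le> length \<mu> \<longleftrightarrow> i \<le> length \<nu>" if "1 \<le> i" for i
    using pos[OF assms(1) that] pos[OF assms(2) that] parts by simp
  have len: "length \<mu> = length \<nu>"
    using le[of "length \<mu>"] le[of "length \<nu>"] by (cases "length \<mu>"; cases "length \<nu>") auto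
  show ?thesis
  proof (rule nth_equalityI[OF len])
    fix i assume "i < length \<mu>"
    then show "\<mu> ! i = \<nu> ! i" using parts[of "Suc i"] len by (simp add: part_def)
  qed
qed

definition partition_of :: "int list set \<Rightarrow> nat list" where
  "partition_of C = (THE \<nu>. is_partition \<nu> \<and> class_of \<nu> = C)"

definition min_delta :: "nat list \<Rightarrow> nat" where
  "min_delta \<nu> = (LEAST n. n > length \<nu> \<and> (\<forall>x\<in>set (QDV n \<nu>). 0 \<le> x))"

section \<open>The maps NU and ND\<close>

definition D1 :: "nat list set" where
  "D1 = {\<gamma>. is_partition \<gamma> \<and> part \<gamma> 1 \<le> length \<gamma> + 2}"

definition NU1 :: "nat list \<Rightarrow> nat list" where
  "NU1 \<gamma> = filter (\<lambda>p. p \<noteq> 0) ((length \<gamma> + 1) # map (\<lambda>p. p - 1) \<gamma>)"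

text \<open>Partial maps on Dyck classes are represented by their graphs.\<close>

inductive NU2 :: "int list set \<Rightarrow> int list set \<Rightarrow> bool" where
  rule_a: "NU2 (dyck_class ([0, 1] @ replicate h 2 @ A @ replicate (h - 1) (-1)))
               (dyck_class ([0] @ replicate (h - 1) 0 @ [1] @ A @ replicate h 1))"
    if "h \<ge> 2"
      and "A = [] \<or> ((\<forall>x\<in>set A. x \<le> 2) \<and> last A \<ge> 0 \<and> rise_le1 A)"
| rule_b: "NU2 (dyck_class ([0, 1] @ replicate k 2 @ B @ replicate k (-1)))
               (dyck_class ([0] @ replicate k 0 @ B @ [0] @ replicate k 1))"
    if "k \<ge> 1"
      and "B = [] \<or> ((\<forall>x\<in>set B. x \<le> 2) \<and> hd B \<le> 1 \<and> last B \<ge> -1 \<and> rise_le1 B)"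

definition NU :: "int list set \<Rightarrow> int list set \<Rightarrow> bool" where
  "NU C C' \<longleftrightarrow> (\<exists>\<gamma>\<in>D1. C = class_of \<gamma> \<and> C' = class_of (NU1 \<gamma>)) \<or> NU2 C C'"

definition ND :: "int list set \<Rightarrow> int list set \<Rightarrow> bool" where
  "ND C C' \<longleftrightarrow> NU C' C"

section \<open>The maps TI and TI2\<close>

text \<open>
  The word \<open>B\<^sub>\<mu> = 01\<^sup>n\<^sup>1 01\<^sup>n\<^sup>2 \<dots> 01\<^sup>n\<^sup>r\<close>, where \<open>r\<close> is the largest part and \<open>n\<^sub>i\<close> the number of
  parts equal to \<open>i\<close>. For \<open>\<mu> = []\<close> we have \<open>r = part \<mu> 1 = 0\<close>, so the word is empty.
\<close>

definition B_word :: "nat list \<Rightarrow> int list" where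
  "B_word \<mu> = concat (map (\<lambda>i. 0 # replicate (count_list \<mu> i) 1) [1..<part \<mu> 1 + 1])"

definition TI :: "nat list \<Rightarrow> int list set" where
  "TI \<mu> = dyck_class (0 # B_word \<mu>)"

text \<open>
  The class at which the iteration of \<open>ND\<close> from \<open>TI \<mu>\<close> stops. It is unique since
  \<open>ND\<close>, the inverse of a bijection, is single-valued.
\<close>

definition TI2 :: "nat list \<Rightarrow> int list set" where
  "TI2 \<mu> = (THE C. ND\<^sup>*\<^sup>* (TI \<mu>) C \<and> (\<nexists>C'. ND C C'))"

section \<open>Flagpole partitions\<close>

definition flagpole :: "nat list \<Rightarrow> bool" where
  "flagpole \<mu> \<longleftrightarrow> is_partition \<mu> \<and> sum_list \<mu> + 8 \<le> 2 * min_delta (partition_of (TI2 \<mu>))"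

definition a0 :: "nat list \<Rightarrow> int" where
  "a0 \<nu> = int (sum_list \<nu>) - int (part \<nu> 1) - int (length \<nu>) + 3"

lemma a0_ge_2:
  assumes "is_partition \<nu>"
  shows "a0 \<nu> \<ge> 2"
proof (cases \<nu>)
  case (Cons p ps)
  have "length ps \<le> sum_list ps" if "\<forall>q\<in>set ps. 0 < q" for ps :: "nat list"
    using that by (induction ps) auto
  then have "length ps \<le> sum_list ps"
    using assms Cons by (simp add: is_partition_def)
  then show ?thesis using Cons by (simp add: a0_def part_def)
qed (simp add: a0_def part_def)

text \<open>
  The vectors \<open>v(\<nu>,a,0)\<close> and \<open>v(\<nu>,a,1)\<close>, meant for \<open>a \<ge> 2\<close>. By \<open>a0_ge_2\<close> every
  integer \<open>a \<ge> a0 \<nu>\<close> is such a natural number.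
\<close>

definition v0 :: "nat list \<Rightarrow> nat \<Rightarrow> int list" where
  "v0 \<nu> a = [0, 0, 1] @ replicate a 2 @ shift_up (B_word \<nu>)"

definition v1 :: "nat list \<Rightarrow> nat \<Rightarrow> int list" where
  "v1 \<nu> a = [0, 0, 1] @ replicate (a - 1) 2 @ shift_up (B_word \<nu>) @ [1]"

end

theory Submission
  imports Defs
begin

text \<open>
  The map ND preserves the deficit and lowers the size by one, so \<open>TI2 \<mu>\<close> is a well-defined terminal
  class of deficit \<open>|\<mu>|\<close>. ND also preserves the property of having a representative \<open>0PQ\<close> with \<open>P\<close> a
  word in \<open>1, 2, 3\<close> and \<open>Q\<close> a word in \<open>0, 1, 2\<close>, which holds for \<open>0B\<^sub>\<mu>\<close>. For the shortest
  nonnegative representative of \<open>TI2 \<mu>\<close>, of length \<open>n\<close>, not lying in \<open>C\<^sub>1\<close> makes the last entry exceed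
  the top of the initial run \<open>01\<dots>m\<close>, so that this vector starts with \<open>00\<close>, or starts with \<open>01\<close>
  and ends in \<open>2\<close>; not lying in \<open>C\<^sub>2\<close> leaves only vectors of deficit at least \<open>2n - 7\<close> and the vectors \<open>001Y\<close> and
  \<open>001Y1\<close> with \<open>Y\<close> a word in \<open>1, 2\<close> ending in \<open>2\<close>. The latter are the \<open>v(\<lambda>,a,\<epsilon>)\<close>, of deficit
  \<open>n - 2 + |\<lambda>|\<close>, and then the deficit is at most \<open>2n - 8\<close> if and only if \<open>a \<ge> a\<^sub>0(\<lambda>)\<close>.
\<close>

section \<open>Partitions and their quasi-Dyck vectors\<close>

text \<open>In a weakly decreasing list the zeros form a suffix, and \<open>part\<close> is 0 beyond
  the end anyway.\<close>

lemma part_filter_nonzero: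
  assumes "sorted_wrt (\<ge>) L"
  shows "part (filter (\<lambda>p. p \<noteq> 0) L) i = part L i"
proof -
  have "L = filter (\<lambda>p. p \<noteq> 0) L @ replicate (length L - length (filter (\<lambda>p. p \<noteq> 0) L)) 0"
    using assms
  proof (induction L)
    case (Cons a L)
    show ?case
    proof (cases "a = 0")
      case True
      then have "\<forall>x\<in>set L. x = 0" using Cons.prems by auto
      then have "L = replicate (length L) 0" by (intro replicate_eqI) auto
      moreover from \<open>\<forall>x\<in>set L. x = 0\<close> have "filter (\<lambda>p. p \<noteq> 0) L = []" by (simp add: filter_empty_conv)
      ultimately show ?thesis using True by simp
    qed (use Cons in simp)
  qed simp
  then obtain k where L: "L = filter (\<lambda>p. p \<noteq> 0) L @ replicate k 0" by blast
  define F where "F = filter (\<lambda>p. p \<noteq> 0) L"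
  have "part F i = part (F @ replicate k 0) i"
    by (auto simp: part_def nth_append)
  then show ?thesis using L unfolding F_def by simp
qed

lemma is_partition_filter:
  assumes "sorted_wrt (\<ge>) L"
  shows "is_partition (filter (\<lambda>p. p \<noteq> 0) L)"
  using assms by (auto simp: is_partition_def sorted_wrt_filter)

lemma part_eq_0_iff:
  assumes "is_partition \<gamma>" "1 \<le> i"
  shows "part \<gamma> i = 0 \<longleftrightarrow> length \<gamma> < i"
  using assms by (auto simp: part_def is_partition_def)

lemma part_eq_0I: "length \<gamma> < i \<Longrightarrow> part \<gamma> i = 0"
  by (simp add: part_def)

lemma length_QDV [simp]: "length (QDV n \<gamma>) = n"
  by (simp add: QDV_def)

lemma nth_QDV: "j < n \<Longrightarrow> QDV n \<gamma> ! j = int j - int (part \<gamma> (n - j))"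
  by (simp add: QDV_def)

lemma last_QDV: "0 < n \<Longrightarrow> last (QDV n \<gamma>) = int n - 1 - int (part \<gamma> 1)"
  by (subst last_conv_nth) (auto simp: nth_QDV of_nat_diff simp flip: length_greater_0_conv)

text \<open>The formula for \<open>QDV n \<gamma>\<close> is solved for the parts: the rise
  condition says that they decrease weakly, and the leading 0 makes the \<open>n\<close>-th one 0,
  so all are nonnegative and fewer than \<open>n\<close> are positive.\<close>

lemma qdv_ex_partition:
  assumes "qdv v"
  obtains \<gamma> where "is_partition \<gamma>" "length \<gamma> < length v" "QDV (length v) \<gamma> = v"
proof -
  define n where "n = length v"
  have n: "n > 0" using assms by (simp add: qdv_def n_def)
  define p where "p i = int (n - i) - v ! (n - i)" for i
  have v0: "v ! 0 = 0" using assms by (auto simp: qdv_def hd_conv_nth)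
  have pn: "p n = 0" by (simp add: p_def v0)
  have dec: "p (Suc i) \<le> p i" if "1 \<le> i" "i < n" for i
  proof -
    have "v ! Suc (n - Suc i) \<le> v ! (n - Suc i) + 1"
      using assms that by (auto simp: qdv_def rise_le1_def n_def)
    moreover have "Suc (n - Suc i) = n - i" using that by simp
    ultimately show ?thesis using that by (simp add: p_def of_nat_diff)
  qed
  have dec': "p j \<le> p i" if "1 \<le> i" "i \<le> j" "j \<le> n" for i j
    using that(2,3)
  proof (induction j rule: dec_induct)
    case (step k)
    then show ?case using dec[of k] that(1) by simp
  qed simp
  define L where "L = map (\<lambda>i. nat (p i)) [1..<n+1]"
  have sL: "sorted_wrt (\<ge>) L"
    unfolding L_def sorted_wrt_map sorted_wrt_iff_nth_less
    by (auto intro!: nat_mono dec' simp del: upt_Suc)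
  define \<gamma> where "\<gamma> = filter (\<lambda>p. p \<noteq> 0) L"
  have partL: "part L i = nat (p i)" if "1 \<le> i" "i \<le> n" for i
    using that by (auto simp: part_def L_def nth_append simp del: upt_Suc)
  have pg: "part \<gamma> i = nat (p i)" if "1 \<le> i" "i \<le> n" for i
    using part_filter_nonzero[OF sL] partL[OF that] by (simp add: \<gamma>_def)
  have isp: "is_partition \<gamma>" unfolding \<gamma>_def by (rule is_partition_filter[OF sL])
  have "part \<gamma> n = 0" using pg[of n] n pn by simp
  then have len: "length \<gamma> < n" using part_eq_0_iff[OF isp, of n] n by simp
  have "QDV n \<gamma> = v"
  proof (rule nth_equalityI)
    fix j assume "j < length (QDV n \<gamma>)"
    then have j: "j < n" by simp
    have "0 \<le> p (n - j)" using dec'[of "n - j" n] j pn by simp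
    then show "QDV n \<gamma> ! j = v ! j" using j pg[of "n - j"] by (simp add: nth_QDV p_def)
  qed (simp add: n_def)
  then show ?thesis using that isp len by (simp add: n_def)
qed

lemma dyck_class_eq_class_of:
  assumes "qdv v"
  obtains \<gamma> where "is_partition \<gamma>" "length \<gamma> < length v" "QDV (length v) \<gamma> = v"
    "dyck_class v = class_of \<gamma>"
  using qdv_ex_partition[OF assms] class_of_eq_dyck_class by metis

lemma QDV_of_dyck_class:
  assumes "qdv v" "is_partition \<gamma>" "dyck_class v = class_of \<gamma>"
  shows "length \<gamma> < length v" "QDV (length v) \<gamma> = v"
proof -
  obtain \<delta> where "is_partition \<delta>" "length \<delta> < length v" "QDV (length v) \<delta> = v"
    "dyck_class v = class_of \<delta>"
    using dyck_class_eq_class_of[OF assms(1)] by metis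
  with class_of_inj[OF assms(2)] assms(3)
  show "length \<gamma> < length v" "QDV (length v) \<gamma> = v" by metis+
qed

lemma dyck_class_lift:
  assumes "qdv u"
  shows "dyck_class (0 # shift_up u) = dyck_class u"
proof -
  have "equivclp dyck_step u (0 # shift_up u)"
    using assms by (intro r_into_equivclp) (simp add: dyck_step_def)
  then show ?thesis unfolding dyck_class_def
    by (auto intro: equivclp_trans equivclp_sym)
qed

lemma QDV_nth_1_if_longer:
  assumes "is_partition \<gamma>" "length \<gamma> < n" "n < m"
  shows "QDV m \<gamma> ! 1 = 1"
proof -
  have "length \<gamma> < m - 1" using assms by linarith
  then show ?thesis using assms by (simp add: nth_QDV part_eq_0I)
qed

text \<open>Every representative but the shortest is a lift \<open>0 # shift_up u\<close> of a QDV
  and so has second entry 1; any other second entry marks the shortest one.\<close>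

lemma QDV_shortest:
  assumes "is_partition \<gamma>" "length \<gamma> < n" "length \<gamma> < m" "QDV m \<gamma> ! 1 \<noteq> 1"
  shows "m \<le> n"
  using QDV_nth_1_if_longer[OF assms(1,2), of m] assms(4) by (meson not_le)

section \<open>Size and deficit\<close>

text \<open>On \<open>QDV n \<gamma>\<close> with \<open>n > length \<gamma>\<close> this is the
  size of \<gamma>: the sum of the positions minus the sum of the entries.\<close>

definition vsize :: "int list \<Rightarrow> int" where
  "vsize v = int (\<Sum>{..<length v}) - sum_list v"

text \<open>The \<open>dinv\<close> condition on an entry \<open>x\<close> and a later entry
  \<open>y\<close>.\<close>

definition dterm :: "int \<Rightarrow> int \<Rightarrow> int" where
  "dterm x y = of_bool (x = y \<or> x = y + 1)"

definition cross :: "int list \<Rightarrow> int list \<Rightarrow> int" where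
  "cross U V = (\<Sum>x\<leftarrow>U. \<Sum>y\<leftarrow>V. dterm x y)"

fun dinv_pairs :: "int list \<Rightarrow> int" where
  "dinv_pairs [] = 0"
| "dinv_pairs (x # xs) = cross [x] xs + dinv_pairs xs"

text \<open>
  A vector is thought of as preceded by the entries \<open>\<dots>, -3, -2, -1\<close>; \<open>neg_term y\<close> counts the
  \<open>dinv\<close> pairs that these form with an entry \<open>y\<close>.
\<close>

definition neg_term :: "int \<Rightarrow> int" where
  "neg_term y = (if y \<ge> 0 then 0 else if y = -1 then 1 else 2)"

text \<open>Size minus \<open>dinv\<close>. A lift only shifts the infinite word formed by the
  imagined negative entries and \<open>v\<close>, so counting pairs with imagined entries makes the
  value depend on the class alone.\<close>

definition defc :: "int list \<Rightarrow> int" where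
  "defc v = vsize v - dinv_pairs v - (\<Sum>y\<leftarrow>v. neg_term y)"

lemma cross_simps [simp]:
  "cross [] V = 0" "cross U [] = 0"
  "cross (x # x' # U) V = cross [x] V + cross (x' # U) V"
  "cross [x] (y # V) = dterm x y + cross [x] V"
  by (simp_all add: cross_def)

lemma cross_append1 [simp]: "cross (U @ W) V = cross U V + cross W V"
  by (simp add: cross_def)

lemma cross_append2 [simp]: "cross U (V @ W) = cross U V + cross U W"
  by (simp add: cross_def sum_list_addf)

lemma cross_replicate1 [simp]: "cross (replicate n x) V = int n * cross [x] V"
  by (simp add: cross_def sum_list_replicate)

lemma cross_replicate2 [simp]: "cross U (replicate n y) = int n * cross U [y]"
  by (simp add: cross_def sum_list_replicate sum_list_const_mult)

lemma cross_shift_up: "cross (shift_up U) (shift_up V) = cross U V"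
  by (simp add: cross_def shift_up_def dterm_def o_def add.commute)

lemma dinv_pairs_append [simp]: "dinv_pairs (U @ V) = dinv_pairs U + dinv_pairs V + cross U V"
proof (induction U)
  case (Cons x U)
  have "cross (x # U) V = cross [x] V + cross U V" by (simp add: cross_def)
  with Cons show ?case by simp
qed simp

lemma dinv_pairs_shift_up [simp]: "dinv_pairs (shift_up v) = dinv_pairs v"
proof (induction v)
  case (Cons x v)
  then show ?case using cross_shift_up[of "[x]" v] by (simp add: shift_up_def)
qed (simp add: shift_up_def)

lemma sum_list_shift_up: "sum_list (shift_up v) = sum_list v + int (length v)"
  by (induction v) (simp_all add: shift_up_def)

lemma vsize_lift: "vsize (0 # shift_up v) = vsize v"
  by (simp add: vsize_def sum_list_shift_up) (simp add: shift_up_def)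

lemma defc_lift: "defc (0 # shift_up v) = defc v"
proof -
  \<comment> \<open>The new 0 takes over from the imagined -1; the other imagined entries move up
    together with the word.\<close>
  have "cross [0] (shift_up v) + (\<Sum>y\<leftarrow>shift_up v. neg_term y) = (\<Sum>y\<leftarrow>v. neg_term y)"
    by (induction v) (auto simp: shift_up_def dterm_def neg_term_def)
  then show ?thesis
    using vsize_lift[of v] unfolding defc_def by (simp add: neg_term_def[of 0])
qed

lemma class_stats:
  assumes "w \<in> dyck_class v"
  shows "vsize w = vsize v" "defc w = defc v"
proof -
  have "equivclp dyck_step v w" using assms by (simp add: dyck_class_def)
  then have "vsize w = vsize v \<and> defc w = defc v"
    by (induction rule: equivclp_induct) (auto simp: dyck_step_def vsize_lift defc_lift)
  then show "vsize w = vsize v" "defc w = defc v" by auto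
qed

definition psize :: "nat list \<Rightarrow> int" where
  "psize \<gamma> = vsize (QDV (Suc (length \<gamma>)) \<gamma>)"

definition pdefc :: "nat list \<Rightarrow> int" where
  "pdefc \<gamma> = defc (QDV (Suc (length \<gamma>)) \<gamma>)"

lemma partition_stats:
  assumes "is_partition \<gamma>" "length \<gamma> < n"
  shows "vsize (QDV n \<gamma>) = psize \<gamma>" "defc (QDV n \<gamma>) = pdefc \<gamma>"
proof -
  have "QDV n \<gamma> \<in> class_of \<gamma>" 
    unfolding class_of_def using assms(2) by blast
  also have "class_of \<gamma> = dyck_class (QDV (Suc (length \<gamma>)) \<gamma>)"
    by (rule class_of_eq_dyck_class[OF assms(1)]) simp
  finally have "QDV n \<gamma> \<in> dyck_class (QDV (Suc (length \<gamma>)) \<gamma>)" .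
  from class_stats[OF this] show "vsize (QDV n \<gamma>) = psize \<gamma>" "defc (QDV n \<gamma>) = pdefc \<gamma>"
    by (simp_all add: psize_def pdefc_def)
qed

text \<open>Makes the iteration of ND terminate, since each step lowers \<open>psize\<close> by
  one.\<close>

lemma psize_nonneg: "0 \<le> psize \<gamma>"
proof -
  define n where "n = Suc (length \<gamma>)"
  have "sum_list (map f [0..<n]) = sum f {0..<n}" for f :: "nat \<Rightarrow> int"
    using sum_set_upt_conv_sum_list_nat[of f 0 n] by simp
  then have "sum_list (QDV n \<gamma>) = (\<Sum>j\<in>{0..<n}. int j - int (part \<gamma> (n - j)))"
    unfolding QDV_def by blast
  also have "\<dots> \<le> (\<Sum>j\<in>{0..<n}. int j)" by (intro sum_mono) simp
  also have "\<dots> = int (\<Sum>{..<n})" by (simp add: lessThan_atLeast0)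
  finally show ?thesis by (simp add: psize_def vsize_def n_def)
qed

section \<open>The map NU\<close>

text \<open>The bound that defines \<open>D1\<close> is what allows
  \<open>length \<gamma> + 1\<close> to stand in front.\<close>

lemma D1_sorted:
  assumes "\<gamma> \<in> D1"
  shows "sorted_wrt (\<ge>) ((length \<gamma> + 1) # map (\<lambda>p. p - 1) \<gamma>)"
proof -
  have s: "sorted_wrt (\<ge>) \<gamma>" using assms by (simp add: D1_def is_partition_def)
  have "p - 1 \<le> length \<gamma> + 1" if "p \<in> set \<gamma>" for p
  proof (cases \<gamma>)
    case (Cons q qs)
    then have "p \<le> q" "q \<le> length \<gamma> + 2" using that s assms by (auto simp: D1_def part_def)
    then show ?thesis by simp
  qed (use that in simp)
  moreover have "sorted_wrt (\<ge>) (map (\<lambda>p. p - 1) \<gamma>)"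
    unfolding sorted_wrt_map by (rule sorted_wrt_mono_rel[OF _ s]) auto
  ultimately show ?thesis by auto
qed

lemma is_partition_NU1: "\<gamma> \<in> D1 \<Longrightarrow> is_partition (NU1 \<gamma>)"
  unfolding NU1_def by (intro is_partition_filter D1_sorted)

lemma part_NU1:
  assumes "\<gamma> \<in> D1" "1 \<le> i"
  shows "part (NU1 \<gamma>) i = (if i = 1 then length \<gamma> + 1 else part \<gamma> (i - 1) - 1)"
  unfolding NU1_def part_filter_nonzero[OF D1_sorted[OF assms(1)]]
  using assms(2) by (auto simp: part_def nth_Cons')

lemma length_NU1: "length (NU1 \<gamma>) \<le> length \<gamma> + 1"
  unfolding NU1_def by (rule order_trans[OF length_filter_le]) simp

lemma NU1_inj:
  assumes "\<gamma> \<in> D1" "\<delta> \<in> D1" "NU1 \<gamma> = NU1 \<delta>"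
  shows "\<gamma> = \<delta>"
proof (rule nth_equalityI)
  show len: "length \<gamma> = length \<delta>"
    using part_NU1[OF assms(1), of 1] part_NU1[OF assms(2), of 1] assms(3) by simp
  fix i assume i: "i < length \<gamma>"
  have "part \<gamma> (Suc i) - 1 = part \<delta> (Suc i) - 1"
    using part_NU1[OF assms(1), of "i + 2"] part_NU1[OF assms(2), of "i + 2"] assms(3) by simp
  then have "\<gamma> ! i - 1 = \<delta> ! i - 1" using i len by (simp add: part_def)
  moreover have "0 < \<gamma> ! i" "0 < \<delta> ! i"
    using assms(1,2) i len by (auto simp: D1_def is_partition_def)
  ultimately show "\<gamma> ! i = \<delta> ! i" by linarith
qed

lemma NU1_surj:
  assumes "is_partition \<gamma>" "\<gamma> \<noteq> []" "length \<gamma> \<le> part \<gamma> 1"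
  obtains \<delta> where "\<delta> \<in> D1" "NU1 \<delta> = \<gamma>"
proof -
  obtain p ps where g: "\<gamma> = p # ps" using assms(2) by (cases \<gamma>) auto
  have p: "Suc (length ps) \<le> p" using assms(3) g by (simp add: part_def)
  \<comment> \<open>The first part \<open>p\<close> must be one more than the length of \<delta>;
    the appended 1s are the parts that \<open>NU1\<close> turns into zeros and drops.\<close>
  define \<delta> where "\<delta> = map Suc ps @ replicate (p - 1 - length ps) 1"
  have len: "length \<delta> = p - 1" using p by (simp add: \<delta>_def)
  have "sorted_wrt (\<ge>) ps" using assms(1) g by (simp add: is_partition_def)
  then have "sorted_wrt (\<ge>) \<delta>"
    unfolding \<delta>_def sorted_wrt_append sorted_wrt_map
    by (auto simp: sorted_wrt_iff_nth_less[of _ "replicate _ _"])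
  moreover have "part \<delta> 1 \<le> p + 1"
    using assms(1) g by (cases ps) (auto simp: \<delta>_def part_def is_partition_def)
  ultimately have "\<delta> \<in> D1" using len p by (auto simp: D1_def is_partition_def \<delta>_def)
  moreover have "NU1 \<delta> = \<gamma>"
  proof -
    have "filter (\<lambda>p. p \<noteq> 0) ps = ps"
      using assms(1) g by (auto simp: filter_id_conv is_partition_def)
    then show ?thesis using p unfolding NU1_def len
      by (auto simp: \<delta>_def g o_def filter_replicate)
  qed
  ultimately show ?thesis using that by blast
qed

text \<open>\<open>NU1\<close> in terms of words: the last entry \<open>y + 1\<close> of the initial
  run \<open>0 1 ... (y+1)\<close> is removed, and \<open>y\<close> is appended at the end.\<close>

lemma QDV_NU1:
  assumes "\<gamma> \<in> D1" and N: "N = length \<gamma> + 2 + y"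
  obtains X where "QDV N (NU1 \<gamma>) = map int [0..<Suc y] @ X @ [int y]"
    "QDV N \<gamma> = map int [0..<Suc (Suc y)] @ X"
proof -
  have isp: "is_partition \<gamma>" using assms(1) by (simp add: D1_def)
  define X where "X = map (\<lambda>j. int (Suc j) - int (part \<gamma> (N - Suc j))) [Suc y..<N - 1]"
  have len: "length X = length \<gamma>" by (simp add: X_def N del: upt_Suc)
  have "QDV N (NU1 \<gamma>) = map int [0..<Suc y] @ X @ [int y]"
  proof (rule nth_equalityI)
    show "length (QDV N (NU1 \<gamma>)) = length (map int [0..<Suc y] @ X @ [int y])"
      by (simp add: len N)
    fix j assume "j < length (QDV N (NU1 \<gamma>))"
    then have j: "j < N" by simp
    have "QDV N (NU1 \<gamma>) ! j = int j - int (part (NU1 \<gamma>) (N - j))" using j by (rule nth_QDV)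
    moreover consider "j < Suc y" | "Suc y \<le> j" "j < N - 1" | "j = N - 1" using j by linarith
    then have "int j - int (part (NU1 \<gamma>) (N - j)) = (map int [0..<Suc y] @ X @ [int y]) ! j"
    proof cases
      case 1
      then have "part (NU1 \<gamma>) (N - j) = 0" using length_NU1[of \<gamma>] N by (intro part_eq_0I) linarith
      then show ?thesis using 1 by (simp add: nth_append del: upt_Suc)
    next
      case 2
      \<comment> \<open>A nonzero part, so the truncated subtraction in \<open>NU1\<close> is exact
        here.\<close>
      then have "part \<gamma> (N - Suc j) \<noteq> 0" using part_eq_0_iff[OF isp, of "N - Suc j"] N by simp
      moreover have "part (NU1 \<gamma>) (N - j) = part \<gamma> (N - Suc j) - 1"
        using part_NU1[OF assms(1), of "N - j"] 2 by simp
      ultimately show ?thesis using 2 len N by (auto simp: nth_append X_def simp del: upt_Suc)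
    next
      case 3
      then have "N - j = 1" using N by simp
      moreover have "(map int [0..<Suc y] @ X @ [int y]) ! j = int y"
        using 3 len N by (simp add: nth_append del: upt_Suc)
      ultimately show ?thesis using part_NU1[OF assms(1), of 1] 3 N by simp
    qed
    ultimately show "QDV N (NU1 \<gamma>) ! j = (map int [0..<Suc y] @ X @ [int y]) ! j" by simp
  qed
  moreover have "QDV N \<gamma> = map int [0..<Suc (Suc y)] @ X"
  proof (rule nth_equalityI)
    fix j assume "j < length (QDV N \<gamma>)"
    then have j: "j < N" by simp
    show "QDV N \<gamma> ! j = (map int [0..<Suc (Suc y)] @ X) ! j"
    proof (cases "j < Suc (Suc y)")
      case True
      then have "part \<gamma> (N - j) = 0" using N by (intro part_eq_0I) linarith
      then show ?thesis using True j by (simp add: nth_QDV nth_append del: upt_Suc)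
    next
      case False
      then have "Suc (Suc (y + (j - Suc (Suc y)))) = j" by simp
      with False show ?thesis using j N by (simp add: nth_QDV nth_append X_def del: upt_Suc)
    qed
  qed (simp add: len N)
  ultimately show ?thesis using that by blast
qed

text \<open>An entry \<open>x\<close> pairs with a later \<open>y\<close>, and an earlier
  \<open>y + 1\<close> pairs with \<open>x\<close>, under the same condition: \<open>x\<close> is
  \<open>y\<close> or \<open>y + 1\<close>. Hence an entry may move across a word from front to
  back, lowered by one, without changing the number of pairs it forms with that word.\<close>

lemma cross_rotate: "cross A [y] = cross [y + 1] A"
  by (induction A) (auto simp: cross_def dterm_def)

lemma dinv_pairs_replicate [simp]: "dinv_pairs (replicate n x) = int (\<Sum>{..<n})"
  by (induction n) (auto simp: dterm_def)

text \<open>The second entry 1 of \<open>0 1 X\<close> moves to the end as 0. By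
  \<open>cross_rotate\<close> its pairs with \<open>X\<close> persist; size grows by one, and so
  does \<open>dinv\<close>, through the pair of the two outer zeros.\<close>

lemma NU1_stats:
  assumes "\<gamma> \<in> D1"
  shows "psize (NU1 \<gamma>) = psize \<gamma> + 1" "pdefc (NU1 \<gamma>) = pdefc \<gamma>"
proof -
  have isp: "is_partition \<gamma>" using assms by (simp add: D1_def)
  define N where "N = length \<gamma> + 2"
  obtain X where X: "QDV N (NU1 \<gamma>) = [0] @ X @ [0]" "QDV N \<gamma> = [0, 1] @ X"
    using QDV_NU1[OF assms, of N 0] by (auto simp: N_def)
  have r: "cross X [0] = cross [1] X" using cross_rotate[of X 0] by simp
  have "vsize (QDV N (NU1 \<gamma>)) = vsize (QDV N \<gamma>) + 1" unfolding X by (simp add: vsize_def)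
  moreover have "defc (QDV N (NU1 \<gamma>)) = defc (QDV N \<gamma>)"
    unfolding X by (simp add: defc_def vsize_def neg_term_def[of 0] neg_term_def[of 1] r dterm_def)
  moreover have "length \<gamma> < N" "length (NU1 \<gamma>) < N" using length_NU1[of \<gamma>] by (auto simp: N_def)
  ultimately show "psize (NU1 \<gamma>) = psize \<gamma> + 1" "pdefc (NU1 \<gamma>) = pdefc \<gamma>"
    using partition_stats[OF isp] partition_stats[OF is_partition_NU1[OF assms]] by metis+
qed

section \<open>The rules (a) and (b) of \<open>NU2\<close>\<close>

lemma rise_le1_Nil [simp]: "rise_le1 []"
  by (simp add: rise_le1_def)

lemma rise_le1_Cons: "rise_le1 (x # xs) \<longleftrightarrow> (xs \<noteq> [] \<longrightarrow> hd xs \<le> x + 1) \<and> rise_le1 xs"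
proof
  assume r: "rise_le1 (x # xs)"
  show "(xs \<noteq> [] \<longrightarrow> hd xs \<le> x + 1) \<and> rise_le1 xs"
    using r[unfolded rise_le1_def, rule_format, of 0] r
    by (force simp: rise_le1_def hd_conv_nth)
next
  assume "(xs \<noteq> [] \<longrightarrow> hd xs \<le> x + 1) \<and> rise_le1 xs"
  then show "rise_le1 (x # xs)"
    by (auto simp: rise_le1_def nth_Cons hd_conv_nth split: nat.splits)
qed

lemma rise_le1_append:
  "rise_le1 (xs @ ys) \<longleftrightarrow>
    rise_le1 xs \<and> rise_le1 ys \<and> (xs \<noteq> [] \<longrightarrow> ys \<noteq> [] \<longrightarrow> hd ys \<le> last xs + 1)"
  by (induction xs) (auto simp: rise_le1_Cons hd_append)

lemma rise_le1_replicate [simp]: "rise_le1 (replicate n x)"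
  by (auto simp: rise_le1_def)

lemma hd_replicate_append: "hd (replicate n x @ ys) = (if n = 0 then hd ys else x)"
  by (cases n) auto

definition a_src :: "nat \<Rightarrow> int list \<Rightarrow> int list" where
  "a_src h A = [0, 1] @ replicate h 2 @ A @ replicate (h - 1) (-1)"

definition a_tgt :: "nat \<Rightarrow> int list \<Rightarrow> int list" where
  "a_tgt h A = [0] @ replicate (h - 1) 0 @ [1] @ A @ replicate h 1"

definition a_cond :: "nat \<Rightarrow> int list \<Rightarrow> bool" where
  "a_cond h A \<longleftrightarrow> h \<ge> 2 \<and> (A = [] \<or> ((\<forall>x\<in>set A. x \<le> 2) \<and> last A \<ge> 0 \<and> rise_le1 A))"

definition b_src :: "nat \<Rightarrow> int list \<Rightarrow> int list" where
  "b_src k B = [0, 1] @ replicate k 2 @ B @ replicate k (-1)"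

definition b_tgt :: "nat \<Rightarrow> int list \<Rightarrow> int list" where
  "b_tgt k B = [0] @ replicate k 0 @ B @ [0] @ replicate k 1"

definition b_cond :: "nat \<Rightarrow> int list \<Rightarrow> bool" where
  "b_cond k B \<longleftrightarrow> k \<ge> 1 \<and>
    (B = [] \<or> ((\<forall>x\<in>set B. x \<le> 2) \<and> hd B \<le> 1 \<and> last B \<ge> -1 \<and> rise_le1 B))"

lemma NU2_iff:
  "NU2 C C' \<longleftrightarrow>
    (\<exists>h A. a_cond h A \<and> C = dyck_class (a_src h A) \<and> C' = dyck_class (a_tgt h A)) \<or>
    (\<exists>k B. b_cond k B \<and> C = dyck_class (b_src k B) \<and> C' = dyck_class (b_tgt k B))"
  unfolding NU2.simps a_src_def a_tgt_def a_cond_def b_src_def b_tgt_def b_cond_def by blast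

lemma a_tgt_eq: "h \<ge> 2 \<Longrightarrow> a_tgt h A = replicate h 0 @ [1] @ A @ replicate h 1"
  by (cases h) (auto simp: a_tgt_def)

lemma b_tgt_eq: "b_tgt k B = replicate (Suc k) 0 @ B @ [0] @ replicate k 1"
  by (simp add: b_tgt_def)

lemma qdv_rules:
  "a_cond h A \<Longrightarrow> qdv (a_src h A)" "a_cond h A \<Longrightarrow> qdv (a_tgt h A)"
  "b_cond k B \<Longrightarrow> qdv (b_src k B)" "b_cond k B \<Longrightarrow> qdv (b_tgt k B)"
proof -
  have hd2: "hd A \<le> 2" if "A \<noteq> []" "\<forall>x\<in>set A. x \<le> 2" for A :: "int list"
    using that by simp
  show "qdv (a_src h A)" if "a_cond h A"
  proof -
    have "\<forall>x\<in>set A. x \<le> 3" using that by (fastforce simp: a_cond_def)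
    then have "A \<noteq> [] \<Longrightarrow> hd A \<le> 3" by simp
    with that show ?thesis
    by (cases "A = []") (auto simp: qdv_def a_cond_def a_src_def rise_le1_Cons rise_le1_append
        hd_replicate_append hd_append)
  qed
  show "qdv (a_tgt h A)" if "a_cond h A"
    using that hd2[of A]
    by (cases "A = []") (auto simp: qdv_def a_cond_def a_tgt_def rise_le1_Cons rise_le1_append
        hd_replicate_append hd_append)
  show "qdv (b_src k B)" if "b_cond k B"
    using that
    by (cases "B = []") (auto simp: qdv_def b_cond_def b_src_def rise_le1_Cons rise_le1_append
        hd_replicate_append hd_append)
  show "qdv (b_tgt k B)" if "b_cond k B"
    using that
    by (cases "B = []") (auto simp: qdv_def b_cond_def b_tgt_def rise_le1_Cons rise_le1_append
        hd_replicate_append hd_append)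
qed

text \<open>The 2s move behind \<open>A\<close> as 1s and the final -1s move in front of it as 0s,
  so \<open>cross_rotate\<close> preserves all pairs with \<open>A\<close>. Among the other entries
  there is exactly one new pair, which offsets the gain in size.\<close>

lemma rule_a_stats:
  assumes "h \<ge> 2"
  shows "vsize (a_tgt h A) = vsize (a_src h A) + 1" "defc (a_tgt h A) = defc (a_src h A)"
proof -
  obtain k where h: "h = Suc k" using assms by (cases h) auto
  have r: "cross A [-1] = cross [0] A" "cross A [1] = cross [2] A"
    using cross_rotate[of A "-1"] cross_rotate[of A 1] by simp_all
  have c: "cross A (1 # replicate k 1) = cross A [1] + int k * cross A [1]"
    using cross_append2[of A "[1]" "replicate k 1"] by simp
  show v: "vsize (a_tgt h A) = vsize (a_src h A) + 1"
    by (simp add: h a_tgt_def a_src_def vsize_def sum_list_replicate)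
  have "dinv_pairs (a_tgt h A) + (\<Sum>y\<leftarrow>a_tgt h A. neg_term y) =
    dinv_pairs (a_src h A) + (\<Sum>y\<leftarrow>a_src h A. neg_term y) + 1"
    by (simp add: h a_tgt_def a_src_def neg_term_def sum_list_replicate c r dterm_def algebra_simps)
  with v show "defc (a_tgt h A) = defc (a_src h A)" by (simp add: defc_def)
qed

text \<open>As for rule (a); here the 1 also moves, to become the 0 behind \<open>B\<close>.\<close>

lemma rule_b_stats:
  shows "vsize (b_tgt k B) = vsize (b_src k B) + 1" "defc (b_tgt k B) = defc (b_src k B)"
proof -
  have r: "cross B [-1] = cross [0] B" "cross B [0] = cross [1] B" "cross B [1] = cross [2] B"
    using cross_rotate[of B "-1"] cross_rotate[of B 0] cross_rotate[of B 1] by simp_all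
  have c: "cross B (0 # replicate k 1) = cross B [0] + int k * cross B [1]"
    using cross_append2[of B "[0]" "replicate k 1"] by simp
  show v: "vsize (b_tgt k B) = vsize (b_src k B) + 1"
    by (simp add: b_tgt_def b_src_def vsize_def sum_list_replicate)
  have "dinv_pairs (b_tgt k B) + (\<Sum>y\<leftarrow>b_tgt k B. neg_term y) =
    dinv_pairs (b_src k B) + (\<Sum>y\<leftarrow>b_src k B. neg_term y) + 1"
    by (simp add: b_tgt_def b_src_def neg_term_def sum_list_replicate c r dterm_def algebra_simps)
  with v show "defc (b_tgt k B) = defc (b_src k B)" by (simp add: defc_def)
qed

section \<open>Shortest nonnegative representatives\<close>

lemma nonneg_QDV_mono:
  assumes "length \<gamma> \<le> m" "m \<le> n" "\<forall>x\<in>set (QDV m \<gamma>). 0 \<le> x"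
  shows "\<forall>x\<in>set (QDV n \<gamma>). 0 \<le> x"
  using assms(2)
proof (induction n rule: dec_induct)
  case (step k)
  then show ?case using QDV_Suc[of \<gamma> k] assms(1) by (auto simp: shift_up_def)
qed (use assms in simp)

lemma part_le_part_1:
  assumes "is_partition \<gamma>"
  shows "part \<gamma> i \<le> part \<gamma> 1"
  using assms by (cases \<gamma>) (auto simp: part_def is_partition_def nth_Cons')

text \<open>The second 0 comes from minimality: without it, removing the first entry and lowering
  the others would leave a shorter nonnegative representative.\<close>

lemma min_delta_props:
  assumes "is_partition \<gamma>" "\<gamma> \<noteq> []"
  shows "length \<gamma> < min_delta \<gamma>" "\<forall>x\<in>set (QDV (min_delta \<gamma>) \<gamma>). 0 \<le> x"
    "0 \<in> set (tl (QDV (min_delta \<gamma>) \<gamma>))"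
proof -
  let ?P = "\<lambda>n. n > length \<gamma> \<and> (\<forall>x\<in>set (QDV n \<gamma>). 0 \<le> x)"
  define n where "n = min_delta \<gamma>"
  \<comment> \<open>At this length every position that carries a positive part is larger than
    \<open>part \<gamma> 1\<close>.\<close>
  have "?P (Suc (length \<gamma> + part \<gamma> 1))"
  proof -
    have "part \<gamma> (Suc (length \<gamma> + part \<gamma> 1) - j) \<le> j" for j
      using part_le_part_1[OF assms(1), of "Suc (length \<gamma> + part \<gamma> 1) - j"]
      by (cases "part \<gamma> 1 \<le> j") (auto simp: part_def)
    then show ?thesis by (auto simp: QDV_def simp del: upt_Suc)
  qed
  then have P: "?P n" unfolding n_def min_delta_def by (rule LeastI)
  show "length \<gamma> < min_delta \<gamma>" "\<forall>x\<in>set (QDV (min_delta \<gamma>) \<gamma>). 0 \<le> x"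
    using P by (auto simp: n_def)
  obtain m where m: "n = Suc m" using P by (cases n) auto
  have lift: "QDV n \<gamma> = 0 # shift_up (QDV m \<gamma>)" using QDV_Suc[of \<gamma> m] P m by simp
  have "0 \<in> set (tl (QDV n \<gamma>))"
  proof (cases "length \<gamma> = m")
    \<comment> \<open>Here \<open>QDV n \<gamma>\<close> is the shortest representative of all, and
      its entry 1 is \<open>1 - part \<gamma> m\<close>.\<close>
    case True
    then have "0 < m" using assms(2) by auto
    then have l: "1 < length (QDV n \<gamma>)" using m by simp
    have "part \<gamma> m > 0" using part_eq_0_iff[OF assms(1), of m] True \<open>0 < m\<close> by simp
    then have "QDV n \<gamma> ! 1 \<le> 0" using l m by (simp add: nth_QDV)
    moreover have "QDV n \<gamma> ! 1 \<ge> 0" using P l nth_mem by blast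
    ultimately have "tl (QDV n \<gamma>) ! 0 = 0" using l by (simp add: nth_tl)
    then show ?thesis using l by (metis length_tl nth_mem zero_less_diff)
  next
    case False
    have "\<not> ?P m" using not_less_Least[of m ?P] m by (simp add: n_def min_delta_def)
    then obtain x where x: "x \<in> set (QDV m \<gamma>)" "x < 0" using False P m by force
    then have "x + 1 \<in> set (tl (QDV n \<gamma>))" using lift by (simp add: shift_up_def)
    moreover have "0 \<le> x + 1" using P x lift by (auto simp: shift_up_def)
    then have "x + 1 = 0" using x(2) by linarith
    ultimately show ?thesis by simp
  qed
  then show "0 \<in> set (tl (QDV (min_delta \<gamma>) \<gamma>))" by (simp add: n_def)
qed

lemma min_delta_eqI:
  assumes "length \<gamma> < n" "\<forall>x\<in>set (QDV n \<gamma>). 0 \<le> x" "0 \<in> set (tl (QDV n \<gamma>))"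
  shows "min_delta \<gamma> = n"
  unfolding min_delta_def
proof (rule Least_equality)
  fix m assume m: "length \<gamma> < m \<and> (\<forall>x\<in>set (QDV m \<gamma>). 0 \<le> x)"
  show "n \<le> m"
  proof (rule ccontr)
    assume "\<not> n \<le> m"
    then obtain k where k: "n = Suc k" "m \<le> k" by (cases n) auto
    have "\<forall>x\<in>set (QDV k \<gamma>). 0 \<le> x" using nonneg_QDV_mono[of \<gamma> m k] m k by simp
    then have "\<forall>x\<in>set (tl (QDV n \<gamma>)). 1 \<le> x"
      using QDV_Suc[of \<gamma> k] m k by (auto simp: shift_up_def)
    then show False using assms(3) by fastforce
  qed
qed (use assms in simp)

section \<open>An invariant of ND\<close>

text \<open>Contains the words in 0, 1, 2 as well as their upward shifts, so that a ternary vector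
  and its lift both have a tail of this form.\<close>

definition mix :: "int list \<Rightarrow> bool" where
  "mix L \<longleftrightarrow> (\<exists>P Q. L = P @ Q \<and> set P \<subseteq> {1, 2, 3} \<and> set Q \<subseteq> {0, 1, 2})"

definition tern :: "int list \<Rightarrow> bool" where
  "tern v \<longleftrightarrow> (\<exists>L. v = 0 # L \<and> mix L)"

definition tpart :: "nat list \<Rightarrow> bool" where
  "tpart \<gamma> \<longleftrightarrow> (\<exists>n > length \<gamma>. tern (QDV n \<gamma>))"

lemma mixI: "L = P @ Q \<Longrightarrow> set P \<subseteq> {1, 2, 3} \<Longrightarrow> set Q \<subseteq> {0, 1, 2} \<Longrightarrow> mix L"
  unfolding mix_def by blast

lemma mix_appendD:
  assumes "mix (xs @ ys)"
  shows "mix xs" "mix ys"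
proof -
  obtain P Q where PQ: "xs @ ys = P @ Q" "set P \<subseteq> {1, 2, 3}" "set Q \<subseteq> {0, 1, 2}"
    using assms by (auto simp: mix_def)
  from PQ(1) obtain us where "xs = P @ us \<and> us @ ys = Q \<or> xs @ us = P \<and> ys = us @ Q"
    unfolding append_eq_append_conv2 by blast
  then have "mix xs \<and> mix ys"
    using PQ mixI[of xs P us] mixI[of ys "[]" ys] mixI[of xs xs "[]"] mixI[of ys us Q] by auto
  then show "mix xs" "mix ys" by auto
qed

lemma mix_append_left: "set P \<subseteq> {1, 2, 3} \<Longrightarrow> mix L \<Longrightarrow> mix (P @ L)"
  unfolding mix_def by (metis Un_least append.assoc set_append)

lemma mix_append_right: "set Q \<subseteq> {0, 1, 2} \<Longrightarrow> mix L \<Longrightarrow> mix (L @ Q)"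
  unfolding mix_def by (metis Un_least append.assoc set_append)

lemma mix_range: "mix L \<Longrightarrow> x \<in> set L \<Longrightarrow> 0 \<le> x \<and> x \<le> 3"
  unfolding mix_def by fastforce

text \<open>A 0 cannot belong to the prefix in 1, 2, 3, so all that follows lies in the ternary
  suffix.\<close>

lemma mix_after_0:
  assumes "mix (xs @ 0 # ys)"
  shows "set ys \<subseteq> {0, 1, 2}"
proof -
  have "mix (0 # ys)" using mix_appendD(2)[OF assms] .
  then obtain P Q where "0 # ys = P @ Q" "set P \<subseteq> {1, 2, 3}" "set Q \<subseteq> {0, 1, 2}"
    by (auto simp: mix_def)
  then show ?thesis by (cases P) auto
qed

lemma mix_last:
  assumes "mix L" "0 \<in> set L"
  shows "last L \<in> {0, 1, 2}"
proof -
  obtain xs ys where L: "L = xs @ 0 # ys" using assms(2) by (meson split_list)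
  then have "set ys \<subseteq> {0, 1, 2}" using assms(1) mix_after_0 by blast
  with L show ?thesis using last_in_set[of ys] by (cases "ys = []") (simp, fastforce)
qed

lemma tern_nonneg: "tern v \<Longrightarrow> \<forall>x\<in>set v. 0 \<le> x"
  unfolding tern_def using mix_range by fastforce

text \<open>Descent by one lift at a time: the tail of the lift is at most 3, so the vector before
  the lift is at most 2, and down to \<open>min_delta\<close> it is nonnegative, hence
  ternary.\<close>

lemma tpart_min_delta:
  assumes "is_partition \<gamma>" "\<gamma> \<noteq> []" "tpart \<gamma>"
  shows "tern (QDV (min_delta \<gamma>) \<gamma>)"
proof -
  obtain n where n: "length \<gamma> < n" "tern (QDV n \<gamma>)" using assms(3) by (auto simp: tpart_def)
  define b where "b = min_delta \<gamma>"
  note md = min_delta_props[OF assms(1,2), folded b_def]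
  have "b \<le> n"
    unfolding b_def min_delta_def using n tern_nonneg by (intro Least_le) simp
  then have "tern (QDV b \<gamma>)"
  proof (induction rule: inc_induct)
    case (step m)
    have len: "length \<gamma> < m" using md(1) step(1) by simp
    have nn: "\<forall>x\<in>set (QDV m \<gamma>). 0 \<le> x"
      using nonneg_QDV_mono[OF _ _ md(2), of m] md(1) step(1) by simp
    have "mix (shift_up (QDV m \<gamma>))"
      using step(3) QDV_Suc[of \<gamma> m] len by (simp add: tern_def)
    then have r: "set (QDV m \<gamma>) \<subseteq> {0, 1, 2}"
      using nn by (fastforce simp: shift_up_def dest: mix_range)
    obtain L where L: "QDV m \<gamma> = 0 # L"
      using qdv_QDV[OF assms(1) len] by (cases "QDV m \<gamma>") (auto simp: qdv_def)
    have "mix L" using r L by (intro mixI[of L "[]" L]) auto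
    then show ?case using L by (simp add: tern_def)
  qed (use n in simp)
  then show ?thesis by (simp add: b_def)
qed

text \<open>In the shortest nonnegative representative of \<open>NU1 \<gamma>\<close> the last entry
  \<open>y\<close> is preceded by a 0 in the tail or is itself such a 0, so it is at most 2. Undoing
  \<open>NU1\<close> moves it to the initial run as \<open>y + 1\<close>, which is at most
  3.\<close>

lemma tpart_NU1:
  assumes "\<gamma> \<in> D1" "tpart (NU1 \<gamma>)"
  shows "tpart \<gamma>"
proof -
  define N where "N = min_delta (NU1 \<gamma>)"
  have p1: "part (NU1 \<gamma>) 1 = length \<gamma> + 1" using part_NU1[OF assms(1), of 1] by simp
  then have ne: "NU1 \<gamma> \<noteq> []" by (auto simp: part_def)
  note md = min_delta_props[OF is_partition_NU1[OF assms(1)] ne, folded N_def]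
  obtain L where L: "QDV N (NU1 \<gamma>) = 0 # L" "mix L"
    using tpart_min_delta[OF is_partition_NU1[OF assms(1)] ne assms(2)] by (auto simp: tern_def N_def)
  have z: "0 \<in> set L" using md(3) L by simp
  then have "last L \<in> {0, 1, 2}" using mix_last L(2) by blast
  moreover have "last L = int N - 1 - int (length \<gamma> + 1)"
    using last_QDV[of N "NU1 \<gamma>"] md(1) L(1) p1 z by (auto split: if_splits)
  \<comment> \<open>The length is expressed through the last entry, as the word form of
    \<open>NU1\<close> requires.\<close>
  ultimately obtain y where y: "N = length \<gamma> + 2 + y" "y \<le> 2"
    by (intro that[of "N - (length \<gamma> + 2)"]) auto
  obtain X where X: "QDV N (NU1 \<gamma>) = map int [0..<Suc y] @ X @ [int y]"
    "QDV N \<gamma> = map int [0..<Suc (Suc y)] @ X"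
    using QDV_NU1[OF assms(1) y(1)] by blast
  have "L = map int [1..<Suc y] @ X @ [int y]"
    using L(1) X(1) by (simp add: upt_conv_Cons del: upt_Suc)
  then have "mix X" using L(2) mix_appendD by blast
  moreover have "set (map int [1..<Suc (Suc y)]) \<subseteq> {1, 2, 3}" using y(2) by auto
  ultimately have "mix (map int [1..<Suc (Suc y)] @ X)" by (rule mix_append_left[rotated])
  moreover have "QDV N \<gamma> = 0 # map int [1..<Suc (Suc y)] @ X"
    using X(2) by (simp add: upt_conv_Cons del: upt_Suc)
  ultimately have "tern (QDV N \<gamma>)" unfolding tern_def by blast
  moreover have "length \<gamma> < N" using y by simp
  ultimately show ?thesis unfolding tpart_def by blast
qed

text \<open>
  Targets of \<open>NU\<^sub>2\<close> start with \<open>00\<close> and end in \<open>1\<close>, so their shortest nonnegative representative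
  needs at most one lift.
\<close>

lemma mix_shift_up_if_tpart:
  assumes "qdv u" "1 < length u" "u ! 1 = 0" "last u = 1"
    and "is_partition \<gamma>" "dyck_class u = class_of \<gamma>" "tpart \<gamma>"
  shows "mix (shift_up u)"
proof -
  define n where "n = length u"
  have u: "length \<gamma> < n" "QDV n \<gamma> = u"
    using QDV_of_dyck_class[OF assms(1,5,6)] by (auto simp: n_def)
  have "part \<gamma> (n - 1) = 1" using assms(2,3) u nth_QDV[of 1 n \<gamma>] by (simp add: n_def)
  then have ne: "\<gamma> \<noteq> []" by (auto simp: part_def split: if_splits)
  define N where "N = min_delta \<gamma>"
  note md = min_delta_props[OF assms(5) ne, folded N_def]
  obtain L where L: "QDV N \<gamma> = 0 # L" "mix L"
    using tpart_min_delta[OF assms(5) ne assms(7)] by (auto simp: tern_def N_def)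
  have z: "0 \<in> set L" using md(3) L by simp
  then have "last L \<in> {0, 1, 2}" using mix_last L(2) by blast
  moreover have "last L = int N - 1 - int (part \<gamma> 1)"
    using last_QDV[of N \<gamma>] md(1) L(1) z by (auto split: if_splits)
  moreover have "1 = int n - 1 - int (part \<gamma> 1)"
    using last_QDV[of n \<gamma>] u assms(4) by simp
  \<comment> \<open>The last entry grows by one with each lift; it is 1 in \<open>u\<close> and at
    most 2 at length \<open>N\<close>.\<close>
  ultimately have "N \<le> Suc n" by auto
  moreover have "n \<le> N" using QDV_shortest[OF assms(5) md(1) u(1)] u assms(3) by simp
  ultimately consider "N = n" | "N = Suc n" by linarith
  then show ?thesis
  proof cases
    case 1
    then have uL: "u = 0 # L" using u L by simp
    then obtain L' where L': "L = 0 # L'" using assms(2,3) by (cases L) auto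
    then have "set L \<subseteq> {0, 1, 2}" using mix_after_0[of "[]" L'] L(2) by auto
    then show ?thesis using uL by (intro mixI[of _ "shift_up u" "[]"]) (auto simp: shift_up_def)
  next
    case 2
    then show ?thesis using L u QDV_Suc[of \<gamma> n] by simp
  qed
qed

lemma tpart_src:
  assumes "is_partition \<delta>" "qdv s" "dyck_class s = class_of \<delta>" "mix (shift_up s)"
  shows "tpart \<delta>"
proof -
  have "length \<delta> < length s" "QDV (length s) \<delta> = s"
    using QDV_of_dyck_class[OF assms(2,1,3)] by auto
  then have "QDV (Suc (length s)) \<delta> = 0 # shift_up s" "length \<delta> < Suc (length s)"
    using QDV_Suc[of \<delta> "length s"] by auto
  then show ?thesis using assms(4) unfolding tpart_def tern_def by blast
qed

lemma shift_up_simps [simp]: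
  "shift_up [] = []" "shift_up (x # xs) = (x + 1) # shift_up xs"
  "shift_up (xs @ ys) = shift_up xs @ shift_up ys"
  "shift_up (replicate n x) = replicate n (x + 1)" "length (shift_up xs) = length xs"
  "set (shift_up xs) = (\<lambda>x. x + 1) ` set xs"
  by (simp_all add: shift_up_def)

lemma tgt_shape:
  assumes "a_cond h A \<and> u = a_tgt h A \<or> b_cond h A \<and> u = b_tgt h A"
  shows "qdv u" "1 < length u" "u ! 1 = 0" "last u = 1"
proof -
  show "qdv u" using assms qdv_rules by blast
  obtain k where k: "h = Suc k" using assms by (cases h) (auto simp: a_cond_def b_cond_def)
  show "1 < length u" "u ! 1 = 0" "last u = 1"
    using assms by (auto simp: k a_tgt_def b_tgt_def a_cond_def b_cond_def nth_append)
qed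

text \<open>Shifted up, a source has letters 1, 2, 3 before the middle word and zeros behind it, so
  only the shifted middle word matters, and that is a factor of the shifted target.\<close>

lemma mix_src:
  "mix (shift_up (a_tgt h A)) \<Longrightarrow> mix (shift_up (a_src h A))"
  "mix (shift_up (b_tgt h A)) \<Longrightarrow> mix (shift_up (b_src h A))"
proof -
  have *: "mix ([1, 2] @ replicate h 3 @ shift_up A @ replicate k 0)" if "mix (shift_up A)" for k
    using that by (intro mix_append_left mix_append_right) auto
  show "mix (shift_up (a_tgt h A)) \<Longrightarrow> mix (shift_up (a_src h A))"
    using *[of "h - 1"] mix_appendD[of "[1] @ replicate (h - 1) 1 @ [2]" "shift_up A @ replicate h 2"]
      mix_appendD[of "shift_up A" "replicate h 2"] by (simp add: a_tgt_def a_src_def)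
  show "mix (shift_up (b_tgt h A)) \<Longrightarrow> mix (shift_up (b_src h A))"
    using *[of h] mix_appendD[of "[1] @ replicate h 1" "shift_up A @ [1] @ replicate h 2"]
      mix_appendD[of "shift_up A" "[1] @ replicate h 2"] by (simp add: b_tgt_def b_src_def)
qed

lemma ND_partition:
  assumes "is_partition \<gamma>" "ND (class_of \<gamma>) C"
  obtains \<delta> where "is_partition \<delta>" "C = class_of \<delta>" "psize \<gamma> = psize \<delta> + 1" "pdefc \<delta> = pdefc \<gamma>"
    "tpart \<gamma> \<Longrightarrow> tpart \<delta>"
proof -
  from assms(2) consider \<delta> where "\<delta> \<in> D1" "C = class_of \<delta>" "class_of \<gamma> = class_of (NU1 \<delta>)"
    | h A s u where "a_cond h A \<and> u = a_tgt h A \<and> s = a_src h A \<or> b_cond h A \<and> u = b_tgt h A \<and> s = b_src h A"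
      "C = dyck_class s" "class_of \<gamma> = dyck_class u"
    unfolding ND_def NU_def NU2_iff by blast
  then show ?thesis
  proof cases
    case 1
    then have "\<gamma> = NU1 \<delta>" using class_of_inj[OF assms(1) is_partition_NU1] by blast
    then show ?thesis using that[of \<delta>] 1 NU1_stats[OF 1(1)] tpart_NU1[OF 1(1)] by (simp add: D1_def)
  next
    case 2
    have s: "qdv s" using 2(1) qdv_rules by blast
    obtain \<delta> where d: "is_partition \<delta>" "length \<delta> < length s" "QDV (length s) \<delta> = s"
      "dyck_class s = class_of \<delta>"
      using dyck_class_eq_class_of[OF s] by blast
    have "a_cond h A \<and> u = a_tgt h A \<or> b_cond h A \<and> u = b_tgt h A" using 2(1) by blast
    note shape = tgt_shape[OF this]
    have g: "length \<gamma> < length u" "QDV (length u) \<gamma> = u"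
      using QDV_of_dyck_class[OF shape(1) assms(1)] 2(3) by auto
    have st: "vsize u = vsize s + 1" "defc u = defc s"
      using 2(1) rule_a_stats[of h A] rule_b_stats[of h A] by (auto simp: a_cond_def)
    have "tpart \<delta>" if "tpart \<gamma>"
    proof -
      have "mix (shift_up u)" using mix_shift_up_if_tpart[OF shape assms(1) _ that] 2(3) by simp
      then have "mix (shift_up s)" using 2(1) mix_src[of h A] by blast
      then show ?thesis using tpart_src[OF d(1) s d(4)] by blast
    qed
    then show ?thesis
      using that[of \<delta>] d st 2(2) partition_stats[OF d(1,2)] partition_stats[OF assms(1) g(1)] g(2)
      by simp
  qed
qed

section \<open>The end point of the iteration of ND\<close>

text \<open>The images of \<open>NU1\<close> and \<open>NU2\<close> are disjoint: starting with
  \<open>00\<close> gives \<open>length \<gamma> \<ge> n - 1\<close>, ending in 1 gives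
  \<open>part \<gamma> 1 = n - 2\<close>, while a value of \<open>NU1\<close> has first part at
  least its length.\<close>

lemma tgt_not_NU1:
  assumes "is_partition \<gamma>" "class_of \<gamma> = dyck_class u"
    and "qdv u" "1 < length u" "u ! 1 = 0" "last u = 1"
    and "\<delta> \<in> D1" "class_of \<gamma> = class_of (NU1 \<delta>)"
  shows False
proof -
  define n where "n = length u"
  have g: "\<gamma> = NU1 \<delta>" using class_of_inj[OF assms(1) is_partition_NU1] assms(7,8) by blast
  have u: "length \<gamma> < n" "QDV n \<gamma> = u"
    using QDV_of_dyck_class[OF assms(3,1)] assms(2) by (auto simp: n_def)
  have "part \<gamma> (n - 1) = 1" using assms(4,5) u nth_QDV[of 1 n \<gamma>] by (simp add: n_def)
  then have "n - 1 \<le> length \<gamma>" by (simp add: part_def split: if_splits)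
  moreover have "1 = int n - 1 - int (part \<gamma> 1)"
    using last_QDV[of n \<gamma>] u assms(6) by simp
  moreover have "part \<gamma> 1 = length \<delta> + 1" "length \<gamma> \<le> length \<delta> + 1"
    using part_NU1[OF assms(7), of 1] length_NU1[of \<delta>] g by auto
  ultimately show False by linarith
qed

text \<open>Both vectors start with \<open>00\<close>, so both are the shortest representative of
  the class.\<close>

lemma tgt_class_eq:
  assumes "qdv u" "1 < length u" "u ! 1 = 0" "qdv w" "1 < length w" "w ! 1 = 0"
    and "dyck_class u = dyck_class w"
  shows "u = w"
proof -
  obtain \<gamma> where g: "is_partition \<gamma>" "length \<gamma> < length u" "QDV (length u) \<gamma> = u"
    "dyck_class u = class_of \<gamma>"
    using dyck_class_eq_class_of[OF assms(1)] by blast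
  have g': "length \<gamma> < length w" "QDV (length w) \<gamma> = w"
    using QDV_of_dyck_class[OF assms(4) g(1)] assms(7) g(4) by auto
  have "length w \<le> length u"
    by (rule QDV_shortest[OF g(1,2) g'(1)]) (use g'(2) assms(6) in simp)
  moreover have "length u \<le> length w"
    by (rule QDV_shortest[OF g(1) g'(1) g(2)]) (use g(3) assms(3) in simp)
  ultimately show ?thesis using g(3) g'(2) by (metis order_antisym)
qed

lemma takeWhile_replicate_append:
  "takeWhile (\<lambda>x. x = c) (replicate n c @ xs) = replicate n c @ takeWhile (\<lambda>x. x = c) xs"
  by (induction n) auto

text \<open>The number of leading zeros is \<open>h\<close>.\<close>

lemma a_tgt_inj: "a_cond h A \<Longrightarrow> a_cond h' A' \<Longrightarrow> a_tgt h A = a_tgt h' A' \<Longrightarrow> h = h' \<and> A = A'"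
proof -
  have *: "length (takeWhile (\<lambda>x. x = 0) (a_tgt h A)) = h" if "a_cond h A" for h A
    using that by (simp add: a_cond_def a_tgt_eq takeWhile_replicate_append)
  assume "a_cond h A" "a_cond h' A'" "a_tgt h A = a_tgt h' A'"
  with *[of h A] *[of h' A'] show "h = h' \<and> A = A'" by (simp add: a_tgt_def)
qed

lemma b_tgt_end: "length (takeWhile (\<lambda>x. x = 1) (rev (b_tgt k B))) = k"
  by (simp add: b_tgt_eq takeWhile_replicate_append)

lemma b_tgt_inj: "b_tgt k B = b_tgt k' B' \<Longrightarrow> k = k' \<and> B = B'"
  using b_tgt_end[of k B] b_tgt_end[of k' B'] by (simp add: b_tgt_def)

text \<open>Rule (a) yields exactly \<open>h\<close> leading zeros and at least \<open>h\<close>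
  final 1s; rule (b) yields at least \<open>k + 1\<close> leading zeros and exactly \<open>k\<close>
  final 1s.\<close>

lemma a_tgt_noteq_b_tgt: "a_cond h A \<Longrightarrow> a_tgt h A \<noteq> b_tgt k B"
proof
  assume "a_cond h A" and eq: "a_tgt h A = b_tgt k B"
  then have "h \<ge> 2" by (simp add: a_cond_def)
  then have "length (takeWhile (\<lambda>x. x = 0) (a_tgt h A)) = h"
    "length (takeWhile (\<lambda>x. x = 1) (rev (a_tgt h A))) \<ge> h"
    by (simp_all add: a_tgt_eq takeWhile_replicate_append)
  moreover have "length (takeWhile (\<lambda>x. x = 0) (b_tgt k B)) \<ge> Suc k"
    unfolding b_tgt_eq takeWhile_replicate_append by simp
  ultimately show False using eq b_tgt_end[of k B] by simp
qed

lemma ND_functional: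
  assumes "is_partition \<gamma>" "ND (class_of \<gamma>) C" "ND (class_of \<gamma>) C'"
  shows "C = C'"
proof -
  have 1: "C = C'" if "\<delta> \<in> D1" "C = class_of \<delta>" "class_of \<gamma> = class_of (NU1 \<delta>)"
    "NU C' (class_of \<gamma>)" for \<delta> C C'
    using that(4) unfolding NU_def
  proof
    assume "\<exists>\<gamma>'\<in>D1. C' = class_of \<gamma>' \<and> class_of \<gamma> = class_of (NU1 \<gamma>')"
    then obtain \<delta>' where d: "\<delta>' \<in> D1" "C' = class_of \<delta>'" "class_of \<gamma> = class_of (NU1 \<delta>')" by blast
    then have "NU1 \<delta> = NU1 \<delta>'"
      using that class_of_inj is_partition_NU1 by metis
    then show ?thesis using NU1_inj d that by blast
  next
    assume "NU2 C' (class_of \<gamma>)"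
    then obtain u where "qdv u" "1 < length u" "u ! 1 = 0" "last u = 1" "class_of \<gamma> = dyck_class u"
      unfolding NU2_iff using tgt_shape by metis
    then show ?thesis using tgt_not_NU1[OF assms(1)] that(1,3) by blast
  qed
  have 2: "C = C'" if C: "NU2 C (class_of \<gamma>)" "NU2 C' (class_of \<gamma>)"
  proof -
    have *: "u = w" if "class_of \<gamma> = dyck_class u" "class_of \<gamma> = dyck_class w"
      "a_cond h A \<and> u = a_tgt h A \<or> b_cond h A \<and> u = b_tgt h A"
      "a_cond k B \<and> w = a_tgt k B \<or> b_cond k B \<and> w = b_tgt k B" for u w h A k B
      using tgt_class_eq[OF tgt_shape(1-3)[OF that(3)] tgt_shape(1-3)[OF that(4)]] that(1,2) by simp
    from C(1)[unfolded NU2_iff] show ?thesis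
    proof (elim disjE exE conjE)
      fix h A
      assume a: "a_cond h A" "C = dyck_class (a_src h A)" "class_of \<gamma> = dyck_class (a_tgt h A)"
      from C(2)[unfolded NU2_iff] show ?thesis
      proof (elim disjE exE conjE)
        fix k B
        assume b: "a_cond k B" "C' = dyck_class (a_src k B)" "class_of \<gamma> = dyck_class (a_tgt k B)"
        then have "a_tgt h A = a_tgt k B" using *[of "a_tgt h A" "a_tgt k B" h A k B] a by blast
        then show ?thesis using a_tgt_inj[of h A k B] a b by simp
      next
        fix k B
        assume b: "b_cond k B" "class_of \<gamma> = dyck_class (b_tgt k B)"
        then have "a_tgt h A = b_tgt k B" using *[of "a_tgt h A" "b_tgt k B" h A k B] a by blast
        then show ?thesis using a_tgt_noteq_b_tgt a(1) by blast
      qed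
    next
      fix h A
      assume a: "b_cond h A" "C = dyck_class (b_src h A)" "class_of \<gamma> = dyck_class (b_tgt h A)"
      from C(2)[unfolded NU2_iff] show ?thesis
      proof (elim disjE exE conjE)
        fix k B
        assume b: "a_cond k B" "class_of \<gamma> = dyck_class (a_tgt k B)"
        then have "b_tgt h A = a_tgt k B" using *[of "b_tgt h A" "a_tgt k B" h A k B] a by blast
        then show ?thesis using a_tgt_noteq_b_tgt b(1) by metis
      next
        fix k B
        assume b: "b_cond k B" "C' = dyck_class (b_src k B)" "class_of \<gamma> = dyck_class (b_tgt k B)"
        then have "b_tgt h A = b_tgt k B" using *[of "b_tgt h A" "b_tgt k B" h A k B] a by blast
        then show ?thesis using b_tgt_inj[of h A k B] a b by simp
      qed
    qed
  qed
  show ?thesis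
  proof (cases "NU2 C (class_of \<gamma>)")
    case True
    show ?thesis
    proof (cases "NU2 C' (class_of \<gamma>)")
      case False
      then show ?thesis using 1[of _ C' C] assms(2,3) unfolding ND_def NU_def by metis
    qed (use True 2 in blast)
  next
    case False
    then show ?thesis using 1[of _ C C'] assms(2,3) unfolding ND_def NU_def by metis
  qed
qed

text \<open>Induction on the size. The last clause, due to \<open>ND_functional\<close>, is the
  uniqueness that the definite description in \<open>TI2\<close> needs.\<close>

lemma ND_iteration:
  assumes "is_partition \<gamma>"
  obtains \<delta> where "is_partition \<delta>" "pdefc \<delta> = pdefc \<gamma>" "tpart \<gamma> \<Longrightarrow> tpart \<delta>"
    "ND\<^sup>*\<^sup>* (class_of \<gamma>) (class_of \<delta>)" "\<nexists>C. ND (class_of \<delta>) C"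
    "\<And>D. ND\<^sup>*\<^sup>* (class_of \<gamma>) D \<Longrightarrow> \<nexists>C. ND D C \<Longrightarrow> D = class_of \<delta>"
  using assms
proof (induction "nat (psize \<gamma>)" arbitrary: \<gamma> thesis rule: less_induct)
  case less
  show ?case
  proof (cases "\<exists>C. ND (class_of \<gamma>) C")
    case False
    then have "D = class_of \<gamma>" if "ND\<^sup>*\<^sup>* (class_of \<gamma>) D" for D
      using that by (metis converse_rtranclpE)
    then show ?thesis using less.prems(1)[of \<gamma>] less.prems(2) False by blast
  next
    case True
    then obtain C where C: "ND (class_of \<gamma>) C" by blast
    obtain \<epsilon> where e: "is_partition \<epsilon>" "C = class_of \<epsilon>" "psize \<gamma> = psize \<epsilon> + 1"
      "pdefc \<epsilon> = pdefc \<gamma>" "tpart \<gamma> \<Longrightarrow> tpart \<epsilon>"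
      using ND_partition[OF less.prems(2) C] by blast
    have "nat (psize \<epsilon>) < nat (psize \<gamma>)" using e(3) psize_nonneg[of \<epsilon>] by simp
    then obtain \<delta> where d: "is_partition \<delta>" "pdefc \<delta> = pdefc \<epsilon>" "tpart \<epsilon> \<Longrightarrow> tpart \<delta>"
      "ND\<^sup>*\<^sup>* (class_of \<epsilon>) (class_of \<delta>)" "\<nexists>C. ND (class_of \<delta>) C"
      "\<And>D. ND\<^sup>*\<^sup>* (class_of \<epsilon>) D \<Longrightarrow> \<nexists>C. ND D C \<Longrightarrow> D = class_of \<delta>"
      using less.hyps[OF _ _ e(1)] by metis
    have reach: "ND\<^sup>*\<^sup>* (class_of \<gamma>) (class_of \<delta>)"
      using C d(4) unfolding e(2) by (rule converse_rtranclp_into_rtranclp)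
    have uniq: "D = class_of \<delta>" if "ND\<^sup>*\<^sup>* (class_of \<gamma>) D" "\<nexists>C. ND D C" for D
      using that(1)
    proof (cases rule: converse_rtranclpE)
      case base
      then show ?thesis using that(2) C by blast
    next
      case (step E)
      then have "E = class_of \<epsilon>" using ND_functional[OF less.prems(2) _ C] e(2) by blast
      then show ?thesis using d(6) step(2) that(2) by blast
    qed
    have "pdefc \<delta> = pdefc \<gamma>" using d(2) e(4) by simp
    then show ?thesis using less.prems(1)[OF d(1) _ _ reach d(5) uniq] d(3) e(5) by blast
  qed
qed

section \<open>The terminal class reached from \<open>TI \<mu>\<close>\<close>

lemma partition_of_class_of:
  assumes "is_partition \<gamma>"
  shows "partition_of (class_of \<gamma>) = \<gamma>"
  unfolding partition_of_def
  by (rule the_equality) (use assms class_of_inj in blast)+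

lemma set_B_word: "set (B_word \<mu>) \<subseteq> {0, 1}"
  by (auto simp: B_word_def)

lemma qdv_0_B_word: "qdv (0 # B_word \<mu>)"
proof -
  have "rise_le1 v" if "set v \<subseteq> {0, 1}" for v :: "int list"
    unfolding rise_le1_def
  proof (intro allI impI)
    fix i assume "Suc i < length v"
    then have "v ! Suc i \<in> {0, 1}" "v ! i \<in> {0, 1}" using that nth_mem by (metis Suc_lessD subsetD)+
    then show "v ! Suc i \<le> v ! i + 1" by auto
  qed
  from this[of "0 # B_word \<mu>"] show ?thesis using set_B_word[of \<mu>] by (simp add: qdv_def)
qed

lemma TI2_partition:
  obtains \<delta> where "is_partition \<delta>" "TI2 \<mu> = class_of \<delta>" "\<nexists>C. ND (class_of \<delta>) C"
    "tpart \<delta>" "pdefc \<delta> = defc (0 # B_word \<mu>)"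
proof -
  let ?v = "0 # B_word \<mu>"
  obtain \<gamma> where g: "is_partition \<gamma>" "length \<gamma> < length ?v" "QDV (length ?v) \<gamma> = ?v"
    "dyck_class ?v = class_of \<gamma>"
    using dyck_class_eq_class_of[OF qdv_0_B_word] by blast
  have "tern ?v" unfolding tern_def using set_B_word[of \<mu>] mixI[of "B_word \<mu>" "[]" "B_word \<mu>"] by auto
  then have t: "tpart \<gamma>" using g unfolding tpart_def by metis
  have p: "pdefc \<gamma> = defc ?v" using partition_stats(2)[OF g(1,2)] g(3) by simp
  obtain \<delta> where d: "is_partition \<delta>" "pdefc \<delta> = pdefc \<gamma>" "tpart \<gamma> \<Longrightarrow> tpart \<delta>"
    "ND\<^sup>*\<^sup>* (class_of \<gamma>) (class_of \<delta>)" "\<nexists>C. ND (class_of \<delta>) C"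
    "\<And>D. ND\<^sup>*\<^sup>* (class_of \<gamma>) D \<Longrightarrow> \<nexists>C. ND D C \<Longrightarrow> D = class_of \<delta>"
    using ND_iteration[OF g(1)] by metis
  have "TI2 \<mu> = class_of \<delta>"
    unfolding TI2_def TI_def g(4) by (rule the_equality) (use d in blast)+
  then show ?thesis using that d t p by metis
qed

section \<open>The deficit of ternary vectors\<close>

abbreviation cnt :: "int list \<Rightarrow> int \<Rightarrow> int" where
  "cnt xs x \<equiv> int (count_list xs x)"

text \<open>
  The deficit contributed by ternary entries that follow a ternary nonnegative vector containing
  \<open>c0\<close> zeros, \<open>c1\<close> ones and \<open>c2\<close> twos.
\<close>

fun dc :: "int \<Rightarrow> int \<Rightarrow> int \<Rightarrow> int list \<Rightarrow> int" where
  "dc c0 c1 c2 [] = 0"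
| "dc c0 c1 c2 (x # xs) =
    (if x = 0 then c2 + dc (c0 + 1) c1 c2 xs
     else if x = 1 then c0 - 1 + dc c0 (c1 + 1) c2 xs
     else c0 + c1 - 2 + dc c0 c1 (c2 + 1) xs)"

lemma length_eq_cnt:
  "set xs \<subseteq> {0, 1, 2} \<Longrightarrow> int (length xs) = cnt xs 0 + cnt xs 1 + cnt xs 2"
  by (induction xs) auto

lemma cross_eq_cnt: "cross xs [y] = cnt xs y + cnt xs (y + 1)"
  by (induction xs) (auto simp: cross_def dterm_def)

lemma count_list_replicate [simp]: "count_list (replicate n x) y = (if x = y then n else 0)"
  by (induction n) auto

text \<open>Appending \<open>x\<close> adds \<open>length u - x\<close> to the size and the number
  of earlier \<open>x\<close> and \<open>x + 1\<close> to \<open>dinv\<close>. As the length is the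
  sum of the three counts, the difference is the summand in \<open>dc\<close>.\<close>

lemma defc_append:
  assumes "set u \<subseteq> {0, 1, 2}" "set xs \<subseteq> {0, 1, 2}"
  shows "defc (u @ xs) = defc u + dc (cnt u 0) (cnt u 1) (cnt u 2) xs"
  using assms
proof (induction xs arbitrary: u)
  case (Cons x xs)
  have "cnt u 3 = 0" using Cons.prems(1) by (auto simp: count_list_0_iff)
  moreover have "defc (u @ [x]) = defc u + int (length u) - x - cross u [x]"
    using Cons.prems(2) by (auto simp: defc_def vsize_def neg_term_def)
  ultimately have "defc (u @ [x]) = defc u + (if x = 0 then cnt u 2
      else if x = 1 then cnt u 0 - 1 else cnt u 0 + cnt u 1 - 2)"
    using Cons.prems length_eq_cnt[OF Cons.prems(1)] cross_eq_cnt[of u x] by auto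
  moreover have "defc ((u @ [x]) @ xs) =
      defc (u @ [x]) + dc (cnt (u @ [x]) 0) (cnt (u @ [x]) 1) (cnt (u @ [x]) 2) xs"
    using Cons.prems by (intro Cons.IH) auto
  ultimately show ?case using Cons.prems by (auto simp: add.commute)
qed simp

lemma dc_append:
  assumes "set xs \<subseteq> {0, 1, 2}"
  shows "dc c0 c1 c2 (xs @ ys) =
    dc c0 c1 c2 xs + dc (c0 + cnt xs 0) (c1 + cnt xs 1) (c2 + cnt xs 2) ys"
  using assms by (induction xs arbitrary: c0 c1 c2) (auto simp: algebra_simps)

lemma dc_replicate:
  "dc c0 c1 c2 (replicate n 0) = int n * c2"
  "dc c0 c1 c2 (replicate n 1) = int n * (c0 - 1)"
  "dc c0 c1 c2 (replicate n 2) = int n * (c0 + c1 - 2)"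
  by (induction n arbitrary: c0 c1 c2) (auto simp: algebra_simps)

lemma set_replicate_ternary:
  "set (replicate n 0) \<subseteq> {0, 1, 2::int}" "set (replicate n 1) \<subseteq> {0, 1, 2::int}"
  "set (replicate n 2) \<subseteq> {0, 1, 2::int}"
  by auto

lemma defc_0_replicate: "defc (replicate z 0) = 0"
  by (simp add: defc_def vsize_def neg_term_def sum_list_replicate)

text \<open>The counts only grow along the word, so each entry contributes at least what the initial
  counts give it.\<close>

lemma dc_ge:
  assumes "set M \<subseteq> {0, 1, 2}" "1 \<le> c0" "1 \<le> c1" "0 \<le> c2"
  shows "cnt M 1 * (c0 - 1) + cnt M 2 * (c0 + c1 - 2) \<le> dc c0 c1 c2 M"
  using assms
proof (induction M arbitrary: c0 c1 c2)
  case (Cons x M)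
  have n: "0 \<le> cnt M 1" "0 \<le> cnt M 2" by auto
  consider "x = 0" | "x = 1" | "x = 2" using Cons.prems(1) by auto
  then show ?case
  proof cases
    case 1
    then show ?thesis using Cons.IH[of "c0 + 1" c1 c2] Cons.prems n by (auto simp: algebra_simps)
  next
    case 2
    then show ?thesis using Cons.IH[of c0 "c1 + 1" c2] Cons.prems n by (auto simp: algebra_simps)
  next
    case 3
    then show ?thesis using Cons.IH[of c0 c1 "c2 + 1"] Cons.prems n by (auto simp: algebra_simps)
  qed
qed simp

text \<open>A \<open>0\<close> followed by a nonzero entry raises the contribution of that entry.\<close>

lemma dc_ge_last:
  assumes "set M \<subseteq> {0, 1, 2}" "M \<noteq> [] \<Longrightarrow> 1 \<le> last M" "1 \<le> c0" "1 \<le> c1" "0 \<le> c2"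
  shows "(c0 - 1) * (cnt M 1 + cnt M 2) + cnt M 0 \<le> dc c0 c1 c2 M"
  using assms
proof (induction M arbitrary: c0 c1 c2)
  case (Cons x M)
  have n: "0 \<le> cnt M 1" "0 \<le> cnt M 2" by auto
  have l: "M \<noteq> [] \<Longrightarrow> 1 \<le> last M" using Cons.prems(2) by simp
  consider "x = 0" | "x = 1" | "x = 2" using Cons.prems(1) by auto
  then show ?case
  proof cases
    case 1
    then have "M \<noteq> []" using Cons.prems(2) by auto
    then have "last M \<in> set M" "1 \<le> last M" using l by simp_all
    then have "last M \<in> set M" "last M \<in> {1, 2}" using Cons.prems(1) by auto
    then have "1 \<le> cnt M 1 + cnt M 2"
      using count_list_0_iff[of M 1] count_list_0_iff[of M 2] by (cases "last M = 1") force+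
    then show ?thesis using 1 Cons.IH[of "c0 + 1" c1 c2] Cons.prems l n by (auto simp: algebra_simps)
  next
    case 2
    then show ?thesis using Cons.IH[of c0 "c1 + 1" c2] Cons.prems l n by (auto simp: algebra_simps)
  next
    case 3
    then show ?thesis using Cons.IH[of c0 c1 "c2 + 1"] Cons.prems l n by (auto simp: algebra_simps)
  qed
qed simp

text \<open>Before the first 0 a 1 contributes at least 1, and a 2 at least 1 plus another 1 at that
  0, whose contribution is the number of earlier 2s. Behind it there are at least three zeros, and
  \<open>dc_ge_last\<close> gives 2 for each nonzero entry and 1 for each further 0.\<close>

lemma dc_ge_zero:
  assumes "set M \<subseteq> {0, 1, 2}" "1 \<le> last M" "0 \<in> set M" "2 \<le> c0" "1 \<le> c1" "0 \<le> c2"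
  shows "c2 + cnt M 0 + cnt M 1 + 2 * cnt M 2 - 1 \<le> dc c0 c1 c2 M"
  using assms
proof (induction M arbitrary: c0 c1 c2)
  case (Cons x M)
  consider "x = 0" | "x = 1" | "x = 2" using Cons.prems(1) by auto
  then show ?case
  proof cases
    case 1
    have "c0 * (cnt M 1 + cnt M 2) + cnt M 0 \<le> dc (c0 + 1) c1 c2 M"
      using dc_ge_last[of M "c0 + 1" c1 c2] Cons.prems by (cases "M = []") simp_all
    moreover have "2 * (cnt M 1 + cnt M 2) \<le> c0 * (cnt M 1 + cnt M 2)"
      using Cons.prems by (intro mult_right_mono) auto
    ultimately show ?thesis using 1 by simp
  next
    case 2
    then show ?thesis using Cons.IH[of c0 "c1 + 1" c2] Cons.prems by (cases "M = []") auto
  next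
    case 3
    then show ?thesis using Cons.IH[of c0 c1 "c2 + 1"] Cons.prems by (cases "M = []") auto
  qed
qed simp

text \<open>After a \<open>0\<close>, a \<open>1\<close> precedes every \<open>2\<close>.\<close>

lemma dc_ge_rise:
  assumes "set M \<subseteq> {0, 1, 2}" "rise_le1 (0 # M)" "2 \<le> c0" "1 \<le> c1" "0 \<le> c2"
  shows "cnt M 1 + 2 * cnt M 2 \<le> dc c0 c1 c2 M"
  using assms
proof (induction M arbitrary: c0 c1 c2)
  case (Cons x M)
  have "x \<noteq> 2" using Cons.prems(2) by (auto simp: rise_le1_Cons)
  then consider "x = 0" | "x = 1" using Cons.prems(1) by auto
  then show ?case
  proof cases
    case 1
    then show ?thesis using Cons.IH[of "c0 + 1" c1 c2] Cons.prems by (auto simp: rise_le1_Cons)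
  next
    case 2
    have "cnt M 1 * (c0 - 1) + cnt M 2 * (c0 + (c1 + 1) - 2) \<le> dc c0 (c1 + 1) c2 M"
      using Cons.prems by (intro dc_ge) auto
    moreover have "cnt M 1 * 1 \<le> cnt M 1 * (c0 - 1)"
      using Cons.prems by (intro mult_left_mono) auto
    moreover have "cnt M 2 * 2 \<le> cnt M 2 * (c0 + (c1 + 1) - 2)"
      using Cons.prems by (intro mult_left_mono) auto
    ultimately show ?thesis using 2 Cons.prems(3) by simp
  qed
qed simp

section \<open>Vectors of small deficit that are not targets of rules (a) and (b)\<close>

lemma leading_run:
  obtains k ys where "xs = replicate k x @ ys" "ys \<noteq> [] \<Longrightarrow> hd ys \<noteq> x"
proof -
  have "xs = replicate (length (takeWhile (\<lambda>y. y = x) xs)) x @ dropWhile (\<lambda>y. y = x) xs"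
    by (induction xs) auto
  moreover have "dropWhile (\<lambda>y. y = x) xs \<noteq> [] \<Longrightarrow> hd (dropWhile (\<lambda>y. y = x) xs) \<noteq> x"
    by (rule hd_dropWhile)
  ultimately show ?thesis using that by blast
qed

lemma trailing_run:
  obtains k ys where "xs = ys @ replicate k x" "ys \<noteq> [] \<Longrightarrow> last ys \<noteq> x"
proof -
  obtain k ys where k: "rev xs = replicate k x @ ys" "ys \<noteq> [] \<Longrightarrow> hd ys \<noteq> x"
    using leading_run[of "rev xs" x] by blast
  have "xs = rev ys @ replicate k x" using arg_cong[OF k(1), of rev] by simp
  then show ?thesis using that[of "rev ys" k] k(2) by (auto simp: last_rev)
qed

lemma replicate_split: "k \<le> n \<Longrightarrow> replicate n x = replicate k x @ replicate (n - k) x"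
  by (metis le_add_diff_inverse replicate_add)

lemma last_ge_if_set: "set xs \<subseteq> {0, 1, 2} \<Longrightarrow> xs \<noteq> [] \<Longrightarrow> (0::int) \<le> last xs"
  using last_in_set[of xs] by fastforce

text \<open>More 1s than 0s would be a target of rule (a), and at least two 0s more than 1s a target
  of rule (b). In the two cases left, the deficit \<open>t * (z - 1)\<close> is quadratic in the
  length.\<close>

lemma binary_two_runs:
  assumes nota: "\<And>h A. a_cond h A \<Longrightarrow> v \<noteq> a_tgt h A" and notb: "\<And>k B. b_cond k B \<Longrightarrow> v \<noteq> b_tgt k B"
    and v: "v = replicate z 0 @ replicate t 1" "2 \<le> z" "1 \<le> t"
  shows "2 * int (length v) < defc v + 8"
proof -
  have "t \<le> z"
  proof (rule ccontr)
    assume "\<not> t \<le> z"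
    then have "replicate t (1::int) = [1] @ replicate (t - z - 1) 1 @ replicate z 1"
      using replicate_split[of 1 t "1::int"] replicate_split[of "t - z - 1" "t - 1" "1::int"] by simp
    then have "v = a_tgt z (replicate (t - z - 1) 1)" using v by (simp add: a_tgt_eq)
    moreover have "a_cond z (replicate (t - z - 1) 1)" using v(2) by (cases "t - z - 1") (auto simp: a_cond_def rise_le1_Cons)
    ultimately show False using nota by blast
  qed
  moreover have "z \<le> Suc t"
  proof (rule ccontr)
    assume "\<not> z \<le> Suc t"
    then have "replicate z (0::int) = replicate (Suc t) 0 @ replicate (z - t - 2) 0 @ [0]"
      using replicate_split[of "Suc t" z "0::int"] replicate_split[of "z - t - 2" "z - Suc t" "0::int"]
      by (simp add: Suc_diff_Suc numeral_2_eq_2)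
    then have "v = b_tgt t (replicate (z - t - 2) 0)" using v by (simp add: b_tgt_eq)
    moreover have "b_cond t (replicate (z - t - 2) 0)" using v(3) by (cases "z - t - 2") (auto simp: b_cond_def rise_le1_Cons)
    ultimately show False using notb by blast
  qed
  ultimately consider "t = z" | "z = Suc t" by linarith
  moreover have "defc v = int t * (int z - 1)"
    using defc_append[of "replicate z 0" "replicate t 1"] v(1) defc_0_replicate[of z]
      set_replicate_ternary
    by (simp add: dc_replicate)
  ultimately show ?thesis
  proof cases
    case 1
    \<comment> \<open>The claim is \<open>z^2 - 5*z + 8 > 0\<close>, and four times the left side is
      \<open>(2*z - 5)^2 + 7\<close>.\<close>
    have "0 \<le> (2 * int z - 5) ^ 2" by simp
    then show ?thesis using \<open>defc v = _\<close> v(1) 1 by (simp add: power2_eq_square algebra_simps)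
  next
    case 2
    \<comment> \<open>The claim is \<open>(t - 2)^2 + 2 > 0\<close>.\<close>
    have "0 \<le> (int t - 2) ^ 2" by simp
    then show ?thesis using \<open>defc v = _\<close> v(1) 2 by (simp add: power2_eq_square algebra_simps)
  qed
qed

lemma deficit_001_2:
  assumes v: "v = replicate z 0 @ [1] @ M @ [2] @ replicate t 1" "2 \<le> z" "t < z"
    and M: "set M \<subseteq> {0, 1, 2}" "M \<noteq> [] \<Longrightarrow> 1 \<le> last M"
    and small: "defc v + 8 \<le> 2 * int (length v)"
  shows "z = 2 \<and> 0 \<notin> set M"
proof -
  define q r s where "q = cnt M 0" and "r = cnt M 1" and "s = cnt M 2"
  have n: "0 \<le> q" "0 \<le> r" "0 \<le> s" by (auto simp: q_def r_def s_def)
  have "defc v = int z - 1 + dc (int z) 1 0 M + (int z + q + r - 1) + int t * (int z + q - 1)"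
    using defc_append[of "replicate z 0" "[1] @ M @ [2] @ replicate t 1"] v(1) defc_0_replicate[of z] M(1)
      set_replicate_ternary
    by (simp add: dc_append dc_replicate q_def r_def algebra_simps)
  moreover have "int (length v) = int z + 2 + q + r + s + int t"
    using v(1) length_eq_cnt[OF M(1)] by (simp add: q_def r_def s_def)
  \<comment> \<open>The deficit bound after cancellation. It fails by \<open>dc_ge_last\<close> if
    \<open>z\<close> is at least 3, and by \<open>dc_ge_zero\<close> if \<open>z = 2\<close> and
    \<open>M\<close> contains a 0.\<close>
  ultimately have ineq: "dc (int z) 1 0 M + int t * (int z + q - 1) + 2 \<le> q + r + 2 * s + 2 * int t"
    using small by simp
  have z2: "z = 2"
  proof (rule ccontr)
    assume "z \<noteq> 2"
    then have z: "3 \<le> int z" using v(2) by simp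
    have "(int z - 1) * (r + s) + q \<le> dc (int z) 1 0 M"
      using dc_ge_last[OF M, of "int z" 1 0] z by (simp add: q_def r_def s_def)
    moreover have "2 * (r + s) \<le> (int z - 1) * (r + s)" using z n by (intro mult_right_mono) auto
    moreover have "int t * 2 \<le> int t * (int z + q - 1)" using z n by (intro mult_left_mono) auto
    ultimately show False using ineq n by (simp add: distrib_left)
  qed
  moreover have "0 \<notin> set M"
  proof
    assume 0: "0 \<in> set M"
    then have q: "1 \<le> q" using count_list_0_iff[of M 0] by (simp add: q_def)
    have "q + r + 2 * s - 1 \<le> dc 2 1 0 M"
      using dc_ge_zero[of M 2 1 0] M 0 by (cases "M = []") (auto simp: q_def r_def s_def)
    moreover have "int t * 2 \<le> int t * (2 + q - 1)" using q by (intro mult_left_mono) auto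
    ultimately show False using ineq z2 q by simp
  qed
  ultimately show ?thesis by simp
qed

text \<open>Write \<open>v\<close> as \<open>0^z 1 M x 1^t\<close> with \<open>x\<close> equal to 0
  or 2. Excluding rule (a) forces \<open>t < z\<close>, then excluding rule (b) forces
  \<open>x = 2\<close>, and the deficit forces \<open>z = 2\<close> and a middle word without
  0.\<close>

lemma small_deficit_00:
  assumes nota: "\<And>h A. a_cond h A \<Longrightarrow> v \<noteq> a_tgt h A" and notb: "\<And>k B. b_cond k B \<Longrightarrow> v \<noteq> b_tgt k B"
    and v: "v = [0, 0] @ v'" "set v \<subseteq> {0, 1, 2}" "rise_le1 v" "1 \<le> last v"
    and small: "defc v + 8 \<le> 2 * int (length v)"
  obtains Y where "set Y \<subseteq> {1, 2}" "Y \<noteq> []" "last Y = 2"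
    "v = [0, 0, 1] @ Y \<or> v = [0, 0, 1] @ Y @ [1]"
proof -
  obtain k w where kw: "v' = replicate k 0 @ w" "w \<noteq> [] \<Longrightarrow> hd w \<noteq> 0"
    using leading_run[of v' 0] by blast
  define z where "z = k + 2"
  have z: "2 \<le> z" and vw: "v = replicate z 0 @ w"
    using kw(1) v(1) by (auto simp: z_def)
  have "w \<noteq> []" using v(4) vw z by auto
  then have "hd w = 1" using kw(2) v(2,3) z by (cases w) (auto simp: vw rise_le1_append)
  obtain t w2 where tw: "w = w2 @ replicate t 1" "w2 \<noteq> [] \<Longrightarrow> last w2 \<noteq> 1"
    using trailing_run[of w 1] by blast
  have "w2 \<noteq> []"
  proof
    assume w2: "w2 = []"
    then have "1 \<le> t" using tw(1) \<open>w \<noteq> []\<close> by (cases t) auto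
    then show False using binary_two_runs[OF nota notb, of z t] vw tw(1) w2 z small by simp
  qed
  with tw(2) have last2: "last w2 \<noteq> 1" by simp
  have "hd w2 = 1" using \<open>hd w = 1\<close> \<open>w2 \<noteq> []\<close> tw(1) by simp
  with \<open>w2 \<noteq> []\<close> last2 obtain w3 where w3: "w2 = 1 # w3" "w3 \<noteq> []"
    by (cases w2) (auto split: if_splits)
  then obtain M x where Mx: "w3 = M @ [x]" by (metis append_butlast_last_id)
  have veq: "v = replicate z 0 @ [1] @ M @ [x] @ replicate t 1"
    using vw tw(1) w3 Mx by simp
  have M: "set M \<subseteq> {0, 1, 2}" and x: "x = 0 \<or> x = 2"
    using v(2) last2 unfolding veq by (auto simp: w3 Mx)
  have "rise_le1 ([1] @ M @ [x] @ replicate t 1)"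
    using v(3) unfolding veq rise_le1_append[of "replicate z 0"] by blast
  then have rise: "rise_le1 (M @ [x] @ replicate t 1)" "rise_le1 ([1] @ M)"
    unfolding rise_le1_append[of "[1]"] rise_le1_append[of M] by auto
  have tz: "t < z"
  proof (rule ccontr)
    assume "\<not> t < z"
    then have rt: "replicate t (1::int) = replicate (t - z) 1 @ replicate z 1"
      using replicate_split[of "t - z" t "1::int"] by simp
    \<comment> \<open>All that lies between the first 1 and the last \<open>z\<close> ones.\<close>
    define A where "A = M @ [x] @ replicate (t - z) 1"
    have "set A \<subseteq> {0, 1, 2}" using M x by (auto simp: A_def)
    moreover have "rise_le1 A"
    proof -
      have "rise_le1 (A @ replicate z 1)" unfolding A_def using rise(1)[unfolded rt] by simp
      then show ?thesis unfolding rise_le1_append[of A] by blast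
    qed
    ultimately have "a_cond z A" using z last_ge_if_set[of A] by (fastforce simp: a_cond_def)
    moreover have "v = a_tgt z A" unfolding a_tgt_eq[OF z] A_def veq by (subst rt) simp
    ultimately show False using nota by blast
  qed
  have "x = 2"
  proof (rule ccontr)
    assume "x \<noteq> 2"
    with x have x0: "x = 0" by simp
    then have t: "1 \<le> t" using v(4) unfolding veq by (cases t) auto
    \<comment> \<open>All that lies between the first \<open>t + 1\<close> zeros and the final
      \<open>0 1^t\<close>.\<close>
    define B where "B = replicate (z - Suc t) 0 @ [1] @ M"
    have "set B \<subseteq> {0, 1, 2}" using M by (auto simp: B_def)
    moreover have "rise_le1 B" using rise(2) by (simp add: B_def rise_le1_append)
    moreover have "hd B \<le> 1" by (simp add: B_def hd_replicate_append)
    ultimately have "b_cond t B" using t last_ge_if_set[of B] by (fastforce simp: b_cond_def)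
    moreover have "v = b_tgt t B"
      using replicate_split[of "Suc t" z "0::int"] tz x0 by (simp add: b_tgt_eq B_def veq)
    ultimately show False using notb by blast
  qed
  have "1 \<le> last M" if "M \<noteq> []"
    using rise(1) that \<open>x = 2\<close> by (simp add: rise_le1_append)
  then have z2: "z = 2" and no0: "0 \<notin> set M"
    using deficit_001_2[of v z M t] veq \<open>x = 2\<close> z tz M small by auto
  have "set (M @ [2]) \<subseteq> {1, 2}" using M no0 by auto
  moreover have "v = [0, 0, 1] @ (M @ [2]) \<or> v = [0, 0, 1] @ (M @ [2]) @ [1]"
  proof -
    consider "t = 0" | "t = 1" using tz z2 by linarith
    then show ?thesis using veq z2 \<open>x = 2\<close> by cases (simp_all add: numeral_2_eq_2)
  qed
  ultimately show ?thesis using that[of "M @ [2]"] by simp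
qed

section \<open>Vectors starting with \<open>01\<close>\<close>

definition shift_down :: "int list \<Rightarrow> int list" where
  "shift_down v = map (\<lambda>x. x - 1) v"

lemma shift_up_down [simp]: "shift_up (shift_down v) = v"
  by (simp add: shift_up_def shift_down_def o_def)

lemma rise_le1_shift_down [simp]: "rise_le1 (shift_down v) = rise_le1 v"
  by (simp add: rise_le1_def shift_down_def diff_le_eq)

text \<open>Targets start with \<open>00\<close>, so only a lifted target could be \<open>v\<close>.
  With \<open>v\<close> written as \<open>0 1^z w3 1 2^t\<close>, excluding rule (b) forces
  \<open>z \<le> t\<close> and excluding rule (a) forces \<open>w3\<close> to start with 0; the
  deficit is then estimated directly.\<close>

lemma large_deficit_01:
  assumes nota: "\<And>h A. a_cond h A \<Longrightarrow> v \<noteq> 0 # shift_up (a_tgt h A)"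
    and notb: "\<And>k B. b_cond k B \<Longrightarrow> v \<noteq> 0 # shift_up (b_tgt k B)"
    and v: "v = 0 # 1 # L" "mix (1 # L)" "rise_le1 v" "0 \<in> set L" "hd L \<le> 1" "last v = 2"
  shows "2 * int (length v) < defc v + 8"
proof -
  obtain k w where kw: "L = replicate k 1 @ w" "w \<noteq> [] \<Longrightarrow> hd w \<noteq> 1"
    using leading_run[of L 1] by blast
  define z where "z = Suc k"
  have vw: "v = 0 # replicate z 1 @ w" using kw(1) v(1) by (simp add: z_def)
  have w0: "0 \<in> set w" using v(4) kw(1) by auto
  then have "w \<noteq> []" by auto
  with kw(2) have hdw: "hd w \<noteq> 1" by simp
  obtain t w2 where tw: "w = w2 @ replicate t 2" "w2 \<noteq> [] \<Longrightarrow> last w2 \<noteq> 2"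
    using trailing_run[of w 2] by blast
  have t: "1 \<le> t" using v(6) tw vw \<open>w \<noteq> []\<close> by (cases t) auto
  have w20: "0 \<in> set w2" using w0 tw(1) by auto
  then have "w2 \<noteq> []" by auto
  with tw(2) have last2: "last w2 \<noteq> 2" by simp
  have mixw: "mix (replicate z 1 @ w2 @ replicate t 2)"
    using v(1,2) kw(1) tw(1) by (simp add: z_def)
  have rw2: "rise_le1 w2" "2 \<le> last w2 + 1" "hd w2 \<le> 2"
    using v(3) t \<open>w2 \<noteq> []\<close> unfolding vw tw(1)
    by (auto simp: rise_le1_Cons rise_le1_append z_def hd_append split: if_splits)
  have range: "0 \<le> y \<and> y \<le> 3" if "y \<in> set w2" for y
    using mix_range[OF mixw] that by auto
  have "last w2 \<in> {0, 1, 2}"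
    using mix_last[of w2] mixw w20 mix_appendD by blast
  then have "last w2 = 1" using last2 rw2(2) by auto
  then obtain w3 where w3: "w2 = w3 @ [1]" using \<open>w2 \<noteq> []\<close> by (metis append_butlast_last_id)
  have w30: "0 \<in> set w3" using w20 w3 by auto
  then have "w3 \<noteq> []" by auto
  have veq: "v = 0 # replicate z 1 @ w3 @ [1] @ replicate t 2" using vw tw(1) w3 by simp
  have rw3: "rise_le1 w3" "hd w3 \<le> 2" using rw2 w3 \<open>w3 \<noteq> []\<close> by (auto simp: rise_le1_append)
  have tz: "z \<le> t"
  proof (rule ccontr)
    assume z: "\<not> z \<le> t"
    define B where "B = replicate (z - Suc t) 0 @ shift_down w3"
    have "\<forall>x\<in>set B. x \<le> 2" using range by (fastforce simp: B_def w3 shift_down_def)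
    moreover have "last B \<ge> -1" "B \<noteq> []"
      using range[of "last w3"] \<open>w3 \<noteq> []\<close> by (auto simp: B_def w3 shift_down_def last_map)
    moreover have "hd B \<le> 1"
      using rw3 \<open>w3 \<noteq> []\<close> by (simp add: B_def hd_replicate_append shift_down_def hd_map)
    moreover have "rise_le1 B"
      using rw3 \<open>w3 \<noteq> []\<close> by (simp add: B_def rise_le1_append) (simp add: shift_down_def hd_map)
    ultimately have "b_cond t B" using t by (simp add: b_cond_def)
    moreover have "v = 0 # shift_up (b_tgt t B)"
      using replicate_split[of "Suc t" z "1::int"] z by (simp add: b_tgt_eq B_def veq)
    ultimately show False using notb by blast
  qed
  have "hd w3 = hd w" using tw(1) w3 \<open>w3 \<noteq> []\<close> by simp
  have "hd w3 = 0"
  proof (rule ccontr)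
    assume "hd w3 \<noteq> 0"
    moreover have "hd w3 \<in> set w2" using \<open>w3 \<noteq> []\<close> w3 by simp
    ultimately have "hd w3 = 2"
      using range[of "hd w3"] hdw \<open>hd w3 = hd w\<close> rw3(2) by linarith
    then obtain M where M: "w3 = 2 # M" using \<open>w3 \<noteq> []\<close> by (cases w3) auto
    \<comment> \<open>Rule (a) needs \<open>h \<ge> 2\<close>; a single 1 followed by 2 would
      contradict \<open>hd L \<le> 1\<close>.\<close>
    have z: "2 \<le> z"
    proof (rule ccontr)
      assume "\<not> 2 \<le> z"
      then have "k = 0" by (simp add: z_def)
      then show False using kw(1) v(5) \<open>hd w3 = hd w\<close> \<open>hd w3 = 2\<close> by simp
    qed
    define A where "A = shift_down (M @ [1] @ replicate (t - z) 2)"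
    have rt: "replicate t (2::int) = replicate (t - z) 2 @ replicate z 2"
      using replicate_split[of "t - z" t "2::int"] tz by simp
    have "\<forall>x\<in>set A. x \<le> 2" using range by (fastforce simp: A_def w3 M shift_down_def)
    moreover have "last A \<ge> 0" by (auto simp: A_def shift_down_def last_map)
    moreover have "rise_le1 A"
      using rw2(1) by (simp add: A_def w3 M rise_le1_append rise_le1_Cons)
    ultimately have "a_cond z A" using z by (simp add: a_cond_def)
    moreover have "v = 0 # shift_up (a_tgt z A)"
      unfolding a_tgt_eq[OF z] A_def veq by (subst rt) (simp add: M)
    ultimately show False using nota by blast
  qed
  then obtain M where M: "w3 = 0 # M" using \<open>w3 \<noteq> []\<close> by (cases w3) auto
  have tern: "set M \<subseteq> {0, 1, 2}"
    using mix_after_0[of "replicate z 1" "M @ [1] @ replicate t 2"] mixw by (simp add: w3 M)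
  define q r s where "q = cnt M 0" and "r = cnt M 1" and "s = cnt M 2"
  have n: "0 \<le> q" "0 \<le> r" "0 \<le> s" by (auto simp: q_def r_def s_def)
  have "defc v = dc 2 (int z) 0 M + (1 + q) + int t * (1 + q + int z + r)"
    using defc_append[of "[0]" "replicate z 1 @ [0] @ M @ [1] @ replicate t 2"] tern
      set_replicate_ternary
    by (simp add: veq w3 M dc_append dc_replicate q_def r_def algebra_simps)
      (simp add: defc_def vsize_def neg_term_def)
  moreover have "int (length v) = 3 + int z + q + r + s + int t"
    using length_eq_cnt[OF tern] by (simp add: veq w3 M q_def r_def s_def)
  moreover have "r + 2 * s \<le> dc 2 (int z) 0 M"
    using dc_ge_rise[of M 2 "int z" 0] tern rw3(1) by (simp add: M q_def r_def s_def z_def)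
  moreover have "q + r \<le> int t * (q + r)" using mult_right_mono[of 1 "int t" "q + r"] t n by simp
  \<comment> \<open>After the other estimates the claim reduces to
    \<open>(t - 2) * (z - 1) + 1 > 0\<close>.\<close>
  moreover have "0 \<le> (int t - 2) * (int z - 1)"
  proof (cases "z = 1")
    case False
    then show ?thesis using tz by (intro mult_nonneg_nonneg) (auto simp: z_def)
  qed simp
  ultimately show ?thesis by (simp add: algebra_simps)
qed

section \<open>The words \<open>B\<^sub>\<mu>\<close>\<close>

text \<open>Covers \<open>B_word\<close> (\<open>c = 0\<close>) and its shift
  (\<open>c = 1\<close>); arbitrary multiplicities \<open>f\<close> allow induction on the number of
  blocks.\<close>

definition blocks :: "int \<Rightarrow> (nat \<Rightarrow> nat) \<Rightarrow> nat \<Rightarrow> int list" where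
  "blocks c f r = concat (map (\<lambda>i. c # replicate (f i) (c + 1)) [1..<Suc r])"

lemma blocks_simps [simp]:
  "blocks c f 0 = []"
  "blocks c f (Suc r) = blocks c f r @ c # replicate (f (Suc r)) (c + 1)"
  by (simp_all add: blocks_def)

lemma B_word_blocks: "B_word \<mu> = blocks 0 (count_list \<mu>) (part \<mu> 1)"
  by (simp add: B_word_def blocks_def)

lemma shift_up_blocks: "shift_up (blocks c f r) = blocks (c + 1) f r"
  by (induction r) simp_all

lemma shift_up_B_word: "shift_up (B_word \<mu>) = blocks 1 (count_list \<mu>) (part \<mu> 1)"
  by (simp add: B_word_blocks shift_up_blocks)

lemma blocks_cong: "(\<And>i. 1 \<le> i \<Longrightarrow> i \<le> r \<Longrightarrow> f i = g i) \<Longrightarrow> blocks c f r = blocks c g r"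
  by (induction r) simp_all

lemma set_blocks: "set (blocks c f r) \<subseteq> {c, c + 1}"
  by (induction r) auto

lemma cnt_blocks: "cnt (blocks c f r) c = int r" "cnt (blocks c f r) (c + 1) = (\<Sum>i=1..r. int (f i))"
  by (induction r) auto

text \<open>In block \<open>i\<close> of the unshifted word each 1 comes after \<open>c0 + i\<close>
  zeros, while zeros contribute nothing for lack of 2s. In the shifted word each 2 of block
  \<open>i\<close> comes after \<open>c0\<close> zeros and \<open>c1 + i\<close> ones.\<close>

lemma dc_blocks:
  "dc c0 c1 0 (blocks 0 f r) = (\<Sum>i=1..r. (c0 + int i - 1) * int (f i))"
  "dc c0 c1 c2 (blocks 1 f r) = int r * (c0 - 1) + (\<Sum>i=1..r. (c0 + c1 + int i - 2) * int (f i))"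
proof -
  have s: "set (blocks 0 f r) \<subseteq> {0, 1, 2}" "set (blocks 1 f r) \<subseteq> {0, 1, 2}" for r
    using set_blocks[of 0 f r] set_blocks[of 1 f r] by auto
  have c: "cnt (blocks 0 f r) 0 = int r" "cnt (blocks 0 f r) 2 = 0"
    "cnt (blocks 1 f r) 0 = 0" "cnt (blocks 1 f r) 1 = int r" for r
    using cnt_blocks(1)[of 0 f r] cnt_blocks(1)[of 1 f r] set_blocks[of 0 f r] set_blocks[of 1 f r]
    by (auto simp: count_list_0_iff)
  show "dc c0 c1 0 (blocks 0 f r) = (\<Sum>i=1..r. (c0 + int i - 1) * int (f i))"
    by (induction r) (simp_all add: dc_append[OF s(1)] c dc_replicate algebra_simps)
  show "dc c0 c1 c2 (blocks 1 f r) = int r * (c0 - 1) + (\<Sum>i=1..r. (c0 + c1 + int i - 2) * int (f i))"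
    by (induction r) (simp_all add: dc_append[OF s(2)] c dc_replicate algebra_simps)
qed

lemma partition_sums:
  assumes "is_partition \<mu>"
  shows "(\<Sum>i=1..part \<mu> 1. int (count_list \<mu> i)) = int (length \<mu>)"
    "(\<Sum>i=1..part \<mu> 1. int i * int (count_list \<mu> i)) = int (sum_list \<mu>)"
proof -
  have sub: "set \<mu> \<subseteq> {1..part \<mu> 1}"
  proof
    fix p assume p: "p \<in> set \<mu>"
    then obtain j where "j < length \<mu>" "p = \<mu> ! j" by (metis in_set_conv_nth)
    then have "p = part \<mu> (Suc j)" by (simp add: part_def)
    then show "p \<in> {1..part \<mu> 1}"
      using part_le_part_1[OF assms, of "Suc j"] assms p by (auto simp: is_partition_def Suc_le_eq)
  qed
  have "sum_list (map f \<mu>) = (\<Sum>i=1..part \<mu> 1. count_list \<mu> i * f i)" for f :: "nat \<Rightarrow> nat"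
    unfolding sum_list_map_eq_sum_count using sub
    by (intro sum.mono_neutral_left) (auto simp: count_list_0_iff)
  from this[of "\<lambda>_. 1"] this[of "\<lambda>x. x"]
  have "length \<mu> = (\<Sum>i=1..part \<mu> 1. count_list \<mu> i)"
    "sum_list \<mu> = (\<Sum>i=1..part \<mu> 1. count_list \<mu> i * i)"
    by (simp_all add: sum_list_triv)
  then show "(\<Sum>i=1..part \<mu> 1. int (count_list \<mu> i)) = int (length \<mu>)"
    "(\<Sum>i=1..part \<mu> 1. int i * int (count_list \<mu> i)) = int (sum_list \<mu>)"
    by (simp_all add: mult.commute)
qed

text \<open>With one leading 0, each 1 in block \<open>i\<close> contributes \<open>i\<close>, and
  these 1s stand for the parts equal to \<open>i\<close>.\<close>

lemma defc_TI:
  assumes "is_partition \<mu>"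
  shows "defc (0 # B_word \<mu>) = int (sum_list \<mu>)"
proof -
  have "defc [0] = 0" by (simp add: defc_def vsize_def neg_term_def)
  then show ?thesis
    using defc_append[of "[0]" "B_word \<mu>"] set_B_word[of \<mu>] partition_sums(2)[OF assms]
    by (force simp: B_word_blocks dc_blocks)
qed

text \<open>Each entry after the two leading zeros contributes 1, and a 2 in block \<open>i\<close>
  contributes \<open>i\<close> more, which sums to the size of \<nu>. The argument
  \<open>Suc a\<close> of \<open>v1\<close> avoids the truncated \<open>a - 1\<close>.\<close>

lemma v_stats:
  assumes "is_partition \<nu>" "v = v0 \<nu> a \<or> v = v1 \<nu> (Suc a)"
  shows "int (length v) = 3 + int (if v = v0 \<nu> a then a else Suc a) + int (part \<nu> 1) + int (length \<nu>)"
    "defc v = int (length v) - 2 + int (sum_list \<nu>)"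
proof -
  define r where "r = part \<nu> 1"
  define b where "b = blocks 1 (count_list \<nu>) r"
  have s: "set b \<subseteq> {0, 1, 2}" using set_blocks[of 1 "count_list \<nu>" r] by (auto simp: b_def)
  have c: "cnt b 0 = 0" "cnt b 1 = int r" "cnt b 2 = int (length \<nu>)"
    using cnt_blocks[of 1 "count_list \<nu>" r] partition_sums(1)[OF assms(1)]
      set_blocks[of 1 "count_list \<nu>" r]
    by (auto simp: count_list_0_iff r_def b_def)
  have len: "int (length b) = int r + int (length \<nu>)" using length_eq_cnt[OF s] c by simp
  have B: "shift_up (B_word \<nu>) = b" by (simp add: shift_up_B_word b_def r_def)
  have d0: "defc [0] = 0" by (simp add: defc_def vsize_def neg_term_def)
  have "(\<Sum>i=1..r. (1 + int i) * int (count_list \<nu> i)) = int (length \<nu>) + int (sum_list \<nu>)"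
    using partition_sums[OF assms(1)] by (simp add: r_def distrib_right sum.distrib)
  then have dcb: "dc 2 1 c2 b = int r + int (length \<nu>) + int (sum_list \<nu>)" for c2
    unfolding b_def dc_blocks by simp
  have 0: "length (v0 \<nu> a) = 3 + a + length b" "length (v1 \<nu> (Suc a)) = 4 + a + length b"
    by (simp_all add: v0_def v1_def B)
  show "int (length v) = 3 + int (if v = v0 \<nu> a then a else Suc a) + int (part \<nu> 1) + int (length \<nu>)"
    using assms(2) 0 len r_def by auto
  have "defc (v0 \<nu> a) = 1 + int a + int r + int (length \<nu>) + int (sum_list \<nu>)"
    using defc_append[of "[0]" "[0, 1] @ replicate a 2 @ b"] d0 s set_replicate_ternary
    by (simp add: v0_def B dc_append dc_replicate dcb c)
  moreover have "defc (v1 \<nu> (Suc a)) = 2 + int a + int r + int (length \<nu>) + int (sum_list \<nu>)"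
    using defc_append[of "[0]" "[0, 1] @ replicate a 2 @ b @ [1]"] d0 s set_replicate_ternary
    by (simp add: v1_def B dc_append dc_replicate dcb c)
  ultimately show "defc v = int (length v) - 2 + int (sum_list \<nu>)"
    using assms(2) 0 len by auto
qed

text \<open>For length \<open>n\<close> the bound becomes \<open>|\<nu>| + 6 \<le> n\<close>, and
  \<open>n\<close> is 3 plus the exponent plus \<open>part \<nu> 1 + length \<nu>\<close>; this is
  how \<open>a0\<close> arises.\<close>

lemma small_deficit_iff:
  assumes "is_partition \<nu>"
  shows "defc (v0 \<nu> a) + 8 \<le> 2 * int (length (v0 \<nu> a)) \<longleftrightarrow> a0 \<nu> \<le> int a"
    "defc (v1 \<nu> (Suc a)) + 8 \<le> 2 * int (length (v1 \<nu> (Suc a))) \<longleftrightarrow> a0 \<nu> \<le> int (Suc a)"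
proof -
  have "v1 \<nu> (Suc a) \<noteq> v0 \<nu> a"
  proof
    assume "v1 \<nu> (Suc a) = v0 \<nu> a"
    then have "length (v1 \<nu> (Suc a)) = length (v0 \<nu> a)" by simp
    then show False by (simp add: v0_def v1_def)
  qed
  then show "defc (v0 \<nu> a) + 8 \<le> 2 * int (length (v0 \<nu> a)) \<longleftrightarrow> a0 \<nu> \<le> int a"
    "defc (v1 \<nu> (Suc a)) + 8 \<le> 2 * int (length (v1 \<nu> (Suc a))) \<longleftrightarrow> a0 \<nu> \<le> int (Suc a)"
    using v_stats[OF assms, of "v0 \<nu> a" a] v_stats[OF assms, of "v1 \<nu> (Suc a)" a]
    by (simp_all add: a0_def) linarith+
qed

section \<open>Reading a partition off a word in 1 and 2\<close>

text \<open>Read from left to right, a 1 opens a new block and a 2 joins the current block, or the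
  initial run if there is none yet. A final 2 makes the last multiplicity nonzero, so that
  \<open>r\<close> can be the largest part.\<close>

lemma ex_blocks:
  assumes "set Y \<subseteq> {1, 2}"
  shows "\<exists>b f r. Y = replicate b 2 @ blocks 1 f r \<and> (r \<noteq> 0 \<longrightarrow> last Y = 2 \<longrightarrow> f r \<noteq> 0)"
  using assms
proof (induction Y rule: rev_induct)
  case Nil
  have "[] = replicate 0 2 @ blocks 1 (\<lambda>_. 0) 0" by simp
  then show ?case by blast
next
  case (snoc y Y)
  then obtain b f r where Y: "Y = replicate b 2 @ blocks 1 f r" by auto
  consider "y = 1" | "y = 2" "r = 0" | r' where "y = 2" "r = Suc r'" using snoc.prems by (cases r) auto
  then show ?case
  proof cases
    case 1
    \<comment> \<open>The value of \<open>f\<close> beyond \<open>r\<close> is arbitrary and must be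
      reset for the empty new block.\<close>
    have "blocks 1 (f(Suc r := 0)) r = blocks 1 f r" by (rule blocks_cong) simp
    then have "Y @ [y] = replicate b 2 @ blocks 1 (f(Suc r := 0)) (Suc r)" using Y 1 by simp
    moreover have "last (Y @ [y]) \<noteq> 2" using 1 by simp
    ultimately show ?thesis by blast
  next
    case 2
    then have "Y @ [y] = replicate (Suc b) 2 @ blocks 1 f 0" using Y by (simp add: replicate_append_same)
    then show ?thesis by blast
  next
    case 3
    have "blocks 1 (f(r := Suc (f r))) r' = blocks 1 f r'" by (rule blocks_cong) (simp add: 3)
    then have "Y @ [y] = replicate b 2 @ blocks 1 (f(r := Suc (f r))) r"
      using Y 3 by (simp add: replicate_append_same)
    moreover have "(f(r := Suc (f r))) r \<noteq> 0" by simp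
    ultimately show ?thesis by blast
  qed
qed

text \<open>\<open>B_word\<close> has as many blocks as the largest part says, so \<open>r\<close>
  must itself occur as a part unless it is 0.\<close>

lemma ex_partition_with_counts:
  "\<exists>\<nu>. is_partition \<nu> \<and> set \<nu> \<subseteq> {..r} \<and> (\<forall>i. 1 \<le> i \<longrightarrow> i \<le> r \<longrightarrow> count_list \<nu> i = f i) \<and>
    (r = 0 \<or> f r \<noteq> 0 \<longrightarrow> part \<nu> 1 = r)"
proof (induction r)
  case 0
  show ?case by (intro exI[of _ "[]"]) (simp add: is_partition_def part_def)
next
  case (Suc r)
  then obtain \<nu> where n: "is_partition \<nu>" "set \<nu> \<subseteq> {..r}"
    "\<forall>i. 1 \<le> i \<longrightarrow> i \<le> r \<longrightarrow> count_list \<nu> i = f i" by blast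
  let ?n = "replicate (f (Suc r)) (Suc r) @ \<nu>"
  have "count_list \<nu> (Suc r) = 0" using n(2) by (auto simp: count_list_0_iff)
  moreover have "is_partition ?n" using n(1,2)
    by (fastforce simp: is_partition_def sorted_wrt_append sorted_wrt_iff_nth_less[of _ "replicate _ _"])
  moreover have "part ?n 1 = Suc r" if "f (Suc r) \<noteq> 0"
    using that by (auto simp: part_def nth_append)
  ultimately show ?case using n by (intro exI[of _ ?n]) (auto simp: le_Suc_eq)
qed

lemma ex_B_word:
  assumes "set Y \<subseteq> {1, 2}" "last Y = 2"
  obtains b \<nu> where "is_partition \<nu>" "Y = replicate b 2 @ shift_up (B_word \<nu>)"
proof -
  obtain b f r where Y: "Y = replicate b 2 @ blocks 1 f r" "r \<noteq> 0 \<longrightarrow> last Y = 2 \<longrightarrow> f r \<noteq> 0"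
    using ex_blocks[OF assms(1)] by blast
  obtain \<nu> where n: "is_partition \<nu>" "\<forall>i. 1 \<le> i \<longrightarrow> i \<le> r \<longrightarrow> count_list \<nu> i = f i" "part \<nu> 1 = r"
    using ex_partition_with_counts[of r f] Y(2) assms(2) by blast
  have "blocks 1 f r = shift_up (B_word \<nu>)"
    unfolding shift_up_B_word n(3) by (rule blocks_cong) (use n(2) in simp)
  then have "Y = replicate b 2 @ shift_up (B_word \<nu>)" using Y(1) by simp
  then show ?thesis by (rule that[OF n(1)])
qed

section \<open>Flagpole partitions\<close>

text \<open>Not being a value of \<open>NU1\<close> means
  \<open>part \<gamma> 1 < length \<gamma>\<close>, and entry \<open>k\<close> at position
  \<open>k\<close> means \<open>length \<gamma> < n - k\<close>; the last entry is
  \<open>n - 1 - part \<gamma> 1\<close>.\<close>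

lemma last_gt_if_terminal:
  assumes "is_partition \<gamma>" "\<gamma> \<noteq> []" "\<nexists>C. ND (class_of \<gamma>) C"
    and "length \<gamma> < n" "k < n" "QDV n \<gamma> ! k = int k"
  shows "int k < last (QDV n \<gamma>)"
proof -
  have "part \<gamma> 1 < length \<gamma>"
  proof (rule ccontr)
    assume "\<not> part \<gamma> 1 < length \<gamma>"
    then have "length \<gamma> \<le> part \<gamma> 1" by simp
    then obtain \<delta> where "\<delta> \<in> D1" "NU1 \<delta> = \<gamma>" by (rule NU1_surj[OF assms(1,2)])
    then have "ND (class_of \<gamma>) (class_of \<delta>)" unfolding ND_def NU_def by blast
    then show False using assms(3) by blast
  qed
  moreover have "length \<gamma> < n - k"
    using assms(5,6) part_eq_0_iff[OF assms(1), of "n - k"] by (simp add: nth_QDV)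
  moreover have "last (QDV n \<gamma>) = int n - 1 - int (part \<gamma> 1)" using assms(4) by (simp add: last_QDV)
  ultimately show ?thesis by linarith
qed

lemma terminal_small_deficit:
  assumes g: "is_partition \<gamma>" "\<gamma> \<noteq> []" "tpart \<gamma>" "\<nexists>C. ND (class_of \<gamma>) C"
    and small: "pdefc \<gamma> + 8 \<le> 2 * int (min_delta \<gamma>)"
  obtains \<nu> a where "is_partition \<nu>" "a0 \<nu> \<le> int a"
    "class_of \<gamma> = dyck_class (v0 \<nu> a) \<or> class_of \<gamma> = dyck_class (v1 \<nu> a)"
proof -
  define n where "n = min_delta \<gamma>"
  define v where "v = QDV n \<gamma>"
  note md = min_delta_props[OF g(1,2), folded n_def, folded v_def]
  have cls: "dyck_class v = class_of \<gamma>" using class_of_eq_dyck_class[OF g(1) md(1)] by (simp add: v_def)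
  have qdv: "qdv v" using qdv_QDV[OF g(1) md(1)] by (simp add: v_def)
  then have rise: "rise_le1 v" by (simp add: qdv_def)
  have len: "length v = n" by (simp add: v_def)
  have sm: "defc v + 8 \<le> 2 * int (length v)"
    using small partition_stats(2)[OF g(1) md(1)] by (simp add: len v_def n_def)
  obtain L where L: "v = 0 # L" "mix L"
    using tpart_min_delta[OF g(1-3)] by (auto simp: tern_def v_def n_def)
  have L0: "0 \<in> set L" using md(3) L by simp
  have final: "int k < last v" if "k < length v" "v ! k = int k" for k
    using last_gt_if_terminal[OF g(1,2,4) md(1), of k] that by (simp add: v_def)
  have lastL: "last v = last L" "last L \<in> {0, 1, 2}" using L0 L mix_last by auto
  have nota: "dyck_class (a_tgt h A) \<noteq> dyck_class v" if "a_cond h A" for h A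
    using that g(4) unfolding cls ND_def NU_def NU2_iff by metis
  have notb: "dyck_class (b_tgt h A) \<noteq> dyck_class v" if "b_cond h A" for h A
    using that g(4) unfolding cls ND_def NU_def NU2_iff by metis
  obtain y L1 where y: "L = y # L1" using L0 by (cases L) auto
  have "y \<le> 1" using rise L(1) y by (simp add: rise_le1_Cons)
  moreover have "0 \<le> y" using mix_range[OF L(2)] y by simp
  ultimately consider "y = 1" | "y = 0" by linarith
  then show ?thesis
  proof cases
    case 1
    have L1: "0 \<in> set L1" using L0 y 1 by simp
    then obtain x L2 where x: "L1 = x # L2" by (cases L1) auto
    have "1 < last v" using final[of 1] L(1) y x 1 by simp
    then have l2: "last v = 2" using lastL by auto
    \<comment> \<open>A run \<open>012\<close> would force a last entry above 2.\<close>
    have "x \<noteq> 2"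
    proof
      assume "x = 2"
      then show False using final[of 2] L(1) y x 1 l2 by simp
    qed
    then have "hd L1 \<le> 1" using rise L(1) y x 1 by (simp add: rise_le1_Cons)
    then have "2 * int (length v) < defc v + 8"
    proof (intro large_deficit_01[of v L1])
      show "v \<noteq> 0 # shift_up (a_tgt h A)" if "a_cond h A" for h A
        using nota[OF that] dyck_class_lift[of "a_tgt h A"] qdv_rules(2)[OF that] by metis
      show "v \<noteq> 0 # shift_up (b_tgt h A)" if "b_cond h A" for h A
        using notb[OF that] dyck_class_lift[of "b_tgt h A"] qdv_rules(4)[OF that] by metis
    qed (use L y 1 rise L1 l2 in simp_all)
    then show ?thesis using sm by simp
  next
    case 2
    have "set v \<subseteq> {0, 1, 2}" using mix_after_0[of "[]" L1] L y 2 by simp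
    moreover have "1 \<le> last v" using final[of 0] L(1) by simp
    moreover have "v = [0, 0] @ L1" using L(1) y 2 by simp
    ultimately obtain Y where Y: "set Y \<subseteq> {1, 2}" "Y \<noteq> []" "last Y = 2"
      "v = [0, 0, 1] @ Y \<or> v = [0, 0, 1] @ Y @ [1]"
      using small_deficit_00[of v L1] nota notb rise sm by metis
    obtain b \<nu> where n: "is_partition \<nu>" "Y = replicate b 2 @ shift_up (B_word \<nu>)"
      using ex_B_word[OF Y(1,3)] by blast
    have "v = v0 \<nu> b \<or> v = v1 \<nu> (Suc b)" using Y(4) n(2) by (simp add: v0_def v1_def)
    then show ?thesis using that[OF n(1)] small_deficit_iff[OF n(1)] sm cls by metis
  qed
qed

lemma qdv_v:
  "qdv (v0 \<nu> a)" "qdv (v1 \<nu> a)"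
proof -
  have r: "rise_le1 w" if "set w \<subseteq> {1, 2}" for w :: "int list"
    unfolding rise_le1_def
  proof (intro allI impI)
    fix i assume "Suc i < length w"
    then have "w ! Suc i \<in> {1, 2}" "w ! i \<in> {1, 2}" using that nth_mem by (metis Suc_lessD subsetD)+
    then show "w ! Suc i \<le> w ! i + 1" by auto
  qed
  have "set (shift_up (B_word \<nu>)) \<subseteq> {1, 2}" using set_B_word[of \<nu>] by auto
  then have "rise_le1 (1 # replicate a 2 @ shift_up (B_word \<nu>))"
    "rise_le1 (1 # replicate (a - 1) 2 @ shift_up (B_word \<nu>) @ [1])"
    by (intro r; auto)+
  then show "qdv (v0 \<nu> a)" "qdv (v1 \<nu> a)"
    by (simp_all add: v0_def v1_def qdv_def rise_le1_Cons[of 0])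
qed

lemma v_nonneg: "\<forall>x\<in>set (v0 \<nu> a). 0 \<le> x" "\<forall>x\<in>set (v1 \<nu> a). 0 \<le> x"
  using set_B_word[of \<nu>] by (auto simp: v0_def v1_def)

theorem theorem4p4:
  fixes \<mu> :: "nat list"
  assumes "is_partition \<mu>"
  shows "flagpole \<mu> \<longleftrightarrow>
    (\<exists>\<nu> (a::nat). is_partition \<nu> \<and> int a \<ge> a0 \<nu> \<and>
       (TI2 \<mu> = dyck_class (v0 \<nu> a) \<or> TI2 \<mu> = dyck_class (v1 \<nu> a)))"
proof -
  obtain \<gamma> where g: "is_partition \<gamma>" "TI2 \<mu> = class_of \<gamma>" "\<nexists>C. ND (class_of \<gamma>) C" "tpart \<gamma>"
    and d: "pdefc \<gamma> = int (sum_list \<mu>)"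
    using TI2_partition[of \<mu>] defc_TI[OF assms] by metis
  have flag: "flagpole \<mu> \<longleftrightarrow> pdefc \<gamma> + 8 \<le> 2 * int (min_delta \<gamma>)"
    using assms d by (auto simp: flagpole_def g(2) partition_of_class_of[OF g(1)])
  show ?thesis
  proof
    assume fl: "flagpole \<mu>"
    \<comment> \<open>The zero partition has \<open>min_delta\<close> at most 1, too small for a
      flagpole.\<close>
    have "\<gamma> \<noteq> []"
    proof
      assume "\<gamma> = []"
      moreover have "min_delta [] \<le> 1" unfolding min_delta_def by (rule Least_le) (simp add: QDV_def part_def)
      ultimately show False using fl flag d by simp
    qed
    then show "\<exists>\<nu> (a::nat). is_partition \<nu> \<and> int a \<ge> a0 \<nu> \<and>
       (TI2 \<mu> = dyck_class (v0 \<nu> a) \<or> TI2 \<mu> = dyck_class (v1 \<nu> a))"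
      using terminal_small_deficit[OF g(1) _ g(4,3)] fl flag g(2) by metis
  next
    assume "\<exists>\<nu> (a::nat). is_partition \<nu> \<and> int a \<ge> a0 \<nu> \<and>
       (TI2 \<mu> = dyck_class (v0 \<nu> a) \<or> TI2 \<mu> = dyck_class (v1 \<nu> a))"
    then obtain \<nu> a v where n: "is_partition \<nu>" "a0 \<nu> \<le> int a" "v = v0 \<nu> a \<or> v = v1 \<nu> a"
      and cls: "dyck_class v = class_of \<gamma>" using g(2) by metis
    have "2 \<le> int a" using a0_ge_2[OF n(1)] n(2) by simp
    then obtain b where b: "a = Suc b" by (cases a) auto
    have v: "qdv v" "\<forall>x\<in>set v. 0 \<le> x" "0 \<in> set (tl v)"
      using n(3) qdv_v[of \<nu> a] v_nonneg[of \<nu> a] by (blast, blast, auto simp: v0_def v1_def)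
    note q = QDV_of_dyck_class[OF v(1) g(1) cls]
    \<comment> \<open>\<open>v\<close> is nonnegative and starts with \<open>00\<close>, so it is
      the shortest nonnegative representative.\<close>
    have "min_delta \<gamma> = length v" using min_delta_eqI[OF q(1)] q(2) v(2,3) by simp
    moreover have "pdefc \<gamma> = defc v" using partition_stats(2)[OF g(1) q(1)] q(2) by simp
    moreover have "defc v + 8 \<le> 2 * int (length v)"
      using n(2,3) small_deficit_iff(1)[OF n(1), of a] small_deficit_iff(2)[OF n(1), of b] b by auto
    ultimately show "flagpole \<mu>" using flag by simp
  qed
qed

end
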